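(* Let $G$ be a locally compact second countable topological group, let $m$ be a probability measure on $G$, and let $X$ be a compact metric $G$-space. The following conditions are equivalent: (1) $X$ is $F_m$-proximal. (2) There is a unique $m$-stationary probability measure $\nu$ on $X$, and the $m$-stationary system $(X,\nu)$ is $m$-proximal.
   Context: A compact metric $G$-space is a compact metric space $(X,d)$ on which $G$ acts continuously by homeomorphisms. For $n\ge1$ put $m_n=\frac1n(m+m^{(2)}+\cdots+m^{(n)})$, where $m^{(j)}=m*m*\cdots*m$ ($j$ times). $X$ is $F_m$-proximal if for all $x,y\in X$ and every $\epsilon>0$, $m_n\{g\in G: d(gx,gy)>\epsilon\}\to0$ as $n\to\infty$. A Borel probability measure $\nu$ on $X$ is $m$-stationary if $m*\nu=\nu$. Let $\Omega=G^{\mathbb{N}}$, $P=m^{\mathbb{N}}$ and let $\xi_n:\Omega\to G$ be the $n$-th coordinate projection. For an $m$-stationary $\nu$, the weak-* limits $\nu_\omega=\lim_{n\to\infty}\xi_1(\omega)\xi_2(\omega)\cdots\xi_n(\omega)\nu$ exist for $P$-a.e. $\omega\in\Omega$. The $m$-stationary system $(X,\nu)$ is $m$-proximal if $\nu_\omega$ is a point mass for $P$-a.e. $\omega$. *)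

theory Defs
  imports "HOL-Probability.Probability"
begin

class compact_metric_space = metric_space +
  assumes compact_UNIV: "compact (UNIV :: 'a set)"

instance compact_metric_space \<subseteq> complete_space
proof
  fix X :: "nat \<Rightarrow> 'a"
  assume "Cauchy X"
  then show "convergent X"
    using compact_imp_complete[OF compact_UNIV] by (auto simp: complete_def convergent_def)
qed

instance compact_metric_space \<subseteq> second_countable_topology
proof
  have "\<exists>K. finite K \<and> (UNIV :: 'a set) \<subseteq> (\<Union>x\<in>K. ball x (1 / Suc n))" for n
    using compact_UNIV[where 'a='a] by (auto simp: compact_eq_totally_bounded)
  then obtain K where K: "\<And>n. finite (K n)"
      "\<And>n. (UNIV :: 'a set) \<subseteq> (\<Union>x\<in>K n. ball x (1 / Suc n))"
    by metis
  define B where "B = (\<Union>n. (\<lambda>x. ball x (1 / Suc n)) ` K n)"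
  have "countable B"
    unfolding B_def using K(1) by (auto intro: countable_finite)
  moreover have "topological_basis B"
  proof (rule topological_basisI)
    fix S and x :: 'a
    assume "open S" "x \<in> S"
    then obtain e where e: "e > 0" "ball x e \<subseteq> S"
      by (auto simp: open_contains_ball)
    obtain n where n: "1 / Suc n < e / 2"
      using nat_approx_posE[of "e / 2"] e(1) by auto
    obtain y where y: "y \<in> K n" "x \<in> ball y (1 / Suc n)"
      using K(2)[of n] by blast
    have "dist x z < e" if "dist y z < 1 / Suc n" for z
      using that y(2) n dist_triangle[of x z y] by (simp add: dist_commute)
    then have "ball y (1 / Suc n) \<subseteq> S"
      using e(2) by auto
    with y show "\<exists>B'\<in>B. x \<in> B' \<and> B' \<subseteq> S"
      unfolding B_def by blast
  qed (auto simp: B_def)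
  ultimately show "\<exists>B :: 'a set set. countable B \<and> open = generate_topology B"
    using topological_basis_imp_subbasis by blast
qed

instance compact_metric_space \<subseteq> polish_space ..

text \<open>
  The group is written additively because the topological group class of the library is additive;
  that class does not assume commutativity. So \<open>g + h\<close> stands for the product \<open>gh\<close>
  and \<open>0\<close> for the identity.
\<close>

definition continuous_action ::
    "('g::topological_group_add \<Rightarrow> 'x::topological_space \<Rightarrow> 'x) \<Rightarrow> bool" where
  "continuous_action act \<longleftrightarrow>
     continuous_on UNIV (\<lambda>(g, x). act g x) \<and>
     (\<forall>x. act 0 x = x) \<and>
     (\<forall>g h x. act (g + h) x = act g (act h x))"

definition borel_prob :: "'a::topological_space measure \<Rightarrow> bool" where
  "borel_prob M \<longleftrightarrow> prob_space M \<and> sets M = sets borel"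

text \<open>
  Convolution along an action. With \<open>act = (+)\<close> this is the convolution of measures on the
  group; the constant \<^const>\<open>convolution\<close> of the library is restricted to Euclidean spaces.
\<close>

definition conv ::
    "('g::topological_space \<Rightarrow> 'x::topological_space \<Rightarrow> 'x) \<Rightarrow> 'g measure \<Rightarrow> 'x measure \<Rightarrow> 'x measure"
  where "conv act m \<nu> = distr (m \<Otimes>\<^sub>M \<nu>) borel (\<lambda>(g, x). act g x)"

text \<open>The power with exponent \<open>0\<close> is the unit of convolution, the point mass at the identity.\<close>

primrec conv_power :: "'g::topological_group_add measure \<Rightarrow> nat \<Rightarrow> 'g measure" where
  "conv_power m 0 = return borel 0"
| "conv_power m (Suc j) = conv (+) m (conv_power m j)"

definition cesaro :: "'g::topological_group_add measure \<Rightarrow> nat \<Rightarrow> 'g set \<Rightarrow> real" where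
  "cesaro m n A = (1 / real n) * (\<Sum>j = 1..n. measure (conv_power m j) A)"

definition F_proximal ::
    "'g::topological_group_add measure \<Rightarrow> ('g \<Rightarrow> 'x::metric_space \<Rightarrow> 'x) \<Rightarrow> bool" where
  "F_proximal m act \<longleftrightarrow>
     (\<forall>x y. \<forall>\<epsilon>>0. (\<lambda>n. cesaro m n {g. dist (act g x) (act g y) > \<epsilon>}) \<longlonglongrightarrow> 0)"

definition stationary ::
    "'g::topological_space measure \<Rightarrow> ('g \<Rightarrow> 'x::topological_space \<Rightarrow> 'x) \<Rightarrow> 'x measure \<Rightarrow> bool" where
  "stationary m act \<nu> \<longleftrightarrow> borel_prob \<nu> \<and> conv act m \<nu> = \<nu>"

definition weak_star_lim :: "(nat \<Rightarrow> 'x::compact_metric_space measure) \<Rightarrow> 'x measure \<Rightarrow> bool" where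
  "weak_star_lim M N \<longleftrightarrow>
     (\<forall>f :: 'x \<Rightarrow> real. continuous_on UNIV f \<longrightarrow> (\<lambda>n. \<integral>x. f x \<partial>M n) \<longlonglongrightarrow> (\<integral>x. f x \<partial>N))"

text \<open>
  The sequence of group elements \<open>\<omega>\<close> is indexed from \<open>0\<close>, so that \<open>\<xi>\<^sub>1 \<dots> \<xi>\<^sub>n\<close> is
  \<open>sum_list (map \<omega> [0..<n]) = \<omega> 0 + \<dots> + \<omega> (n - 1)\<close>, in this order. The condition says that the
  limit \<open>\<nu>\<^sub>\<omega>\<close> is the point mass at some \<open>x\<close>, for almost every \<open>\<omega>\<close>.
\<close>

definition m_proximal ::
    "'g::topological_group_add measure \<Rightarrow> ('g \<Rightarrow> 'x::compact_metric_space \<Rightarrow> 'x) \<Rightarrow> 'x measure \<Rightarrow> bool"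
  where
  "m_proximal m act \<nu> \<longleftrightarrow>
     (AE \<omega> in (\<Pi>\<^sub>M i\<in>(UNIV :: nat set). m).
        \<exists>x. weak_star_lim (\<lambda>n. distr \<nu> borel (act (sum_list (map \<omega> [0..<n])))) (return borel x))"

end

theory Submission
  imports Defs
begin

text \<open>
  Write \<open>w\<^sub>n = \<xi>\<^sub>1 \<dots> \<xi>\<^sub>n\<close>, whose law is the \<open>n\<close>-th convolution power of \<open>m\<close>. Since the metric is bounded,
  \<open>X\<close> is \<open>F\<^sub>m\<close>-proximal iff the Cesaro means of \<open>E d(w\<^sub>n x, w\<^sub>n y)\<close> vanish for all \<open>x, y\<close>.

  If \<open>X\<close> is \<open>F\<^sub>m\<close>-proximal, integrating this against two stationary measures shows that they agree, and
  integrating it against \<open>\<nu> \<times> \<nu>\<close> shows that at some time \<open>w\<^sub>n \<nu>\<close> is close to a point mass \<open>\<delta>\<^sub>z\<close> with high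
  probability. The function \<open>g \<mapsto> \<integral> d(gx, z) d\<nu>(x)\<close> is a nonnegative martingale along the walk, so by the
  maximal inequality \<open>w\<^sub>n \<nu>\<close> then stays close to \<open>\<delta>\<^sub>z\<close> for ever; no martingale convergence is needed.

  Conversely, let \<open>\<nu>\<close> be the only stationary measure. Then Cesaro means of \<open>E f(w\<^sub>i x)\<close> converge to
  \<open>\<integral> f d\<nu>\<close> for continuous \<open>f\<close>. Apply this to \<open>h(u) = E \<integral> d(w\<^sub>k x, w\<^sub>k u) d\<nu>(x)\<close>, whose \<open>\<nu>\<close>-integral is small for large
  \<open>k\<close> by \<open>m\<close>-proximality, and use \<open>E d(w\<^bsub>k+i\<^esub> x, w\<^bsub>k+i\<^esub> y) \<le> E h(w\<^sub>i x) + E h(w\<^sub>i y)\<close>.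
\<close>

section \<open>Functions and measures on a compact metric space\<close>

lemma continuous_real_bounded:
  fixes f :: "'x::compact_metric_space \<Rightarrow> real"
  assumes "continuous_on UNIV f"
  obtains B where "0 < B" "\<And>x. \<bar>f x\<bar> \<le> B"
proof -
  have "bounded (range f)"
    using compact_continuous_image[OF assms compact_UNIV] by (rule compact_imp_bounded)
  then obtain B where "\<And>x. \<bar>f x\<bar> \<le> B"
    by (auto simp: bounded_real)
  then show thesis
    by (intro that[of "max 1 B"]) (auto simp: le_max_iff_disj)
qed

lemma bounded_distances:
  obtains D :: real where "0 < D" "\<And>x y :: 'x::compact_metric_space. dist x y \<le> D"
proof -
  have "bounded (UNIV :: 'x set)"
    by (rule compact_imp_bounded[OF compact_UNIV])
  then obtain D where "\<And>x y :: 'x. dist x y \<le> D"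
    by (auto simp: bounded_two_points)
  then show thesis
    by (intro that[of "max 1 D"]) (auto simp: le_max_iff_disj)
qed

lemma borel_probD:
  assumes "borel_prob \<nu>"
  shows "prob_space \<nu>" "sets \<nu> = sets borel"
  using assms by (auto simp: borel_prob_def)

text \<open>Closed sets are an intersection-stable generator of the Borel sets, and the indicator of
  a nonempty closed set is the pointwise limit of Lipschitz cut-offs of the distance to it. Test
  functions with values in [0,1] suffice, so callers have the bound 1 at hand.\<close>

lemma measure_eqI_continuous:
  fixes M N :: "'x::metric_space measure"
  assumes M: "borel_prob M" and N: "borel_prob N"
    and eq: "\<And>f. continuous_on UNIV f \<Longrightarrow> (\<And>x. 0 \<le> f x \<and> f x \<le> 1) \<Longrightarrow> (\<integral>x. f x \<partial>M) = (\<integral>x. f x \<partial>N :: real)"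
  shows "M = N"
proof (rule measure_eqI_generator_eq[where E = "Collect closed" and \<Omega> = UNIV and A = "\<lambda>_. UNIV"])
  interpret M: prob_space M using M by (simp add: borel_prob_def)
  interpret N: prob_space N using N by (simp add: borel_prob_def)
  have sets: "sets M = sets borel" "sets N = sets borel"
    using M N by (simp_all add: borel_prob_def)
  show "Int_stable (Collect closed :: 'x set set)" by (auto simp: Int_stable_def)
  show "sets M = sigma_sets UNIV (Collect closed)" "sets N = sigma_sets UNIV (Collect closed)"
    unfolding sets borel_eq_closed by simp_all
  fix C :: "'x set" assume "C \<in> Collect closed"
  then have C: "closed C" by simp
  show "emeasure M C = emeasure N C"
  \<comment> \<open>By convention \<open>infdist\<close> to the empty set is 0, so the cut-offs
    below would not approximate its indicator.\<close>
  proof (cases "C = {}")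
    case False
    define f where "f n x = max 0 (1 - real n * infdist x C)" for n x
    have cont: "continuous_on UNIV (f n)" for n
      unfolding f_def by (intro continuous_intros)
    have range: "0 \<le> f n x \<and> f n x \<le> 1" for n x
      unfolding f_def by (auto simp: infdist_nonneg)
    have lim: "(\<lambda>n. f n x) \<longlonglongrightarrow> indicator C x" for x
    proof (cases "x \<in> C")
      case True
      then show ?thesis by (simp add: f_def)
    next
      case nC: False
      have pos: "infdist x C > 0"
        using C False nC infdist_nonneg[of x C] by (simp add: in_closed_iff_infdist_zero less_le)
      obtain n0 :: nat where n0: "1 < real n0 * infdist x C"
        using reals_Archimedean3[OF pos] by blast
      have "f n x = 0" if "n \<ge> n0" for n
      proof -
        have "real n0 * infdist x C \<le> real n * infdist x C"
          using that pos by (intro mult_right_mono) auto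
        with n0 show ?thesis by (simp add: f_def)
      qed
      then have "eventually (\<lambda>n. f n x = 0) sequentially"
        by (auto simp: eventually_sequentially)
      with nC show ?thesis by (simp add: tendsto_eventually)
    qed
    have conv: "(\<lambda>n. \<integral>x. f n x \<partial>L) \<longlonglongrightarrow> measure L C" if L: "borel_prob L" for L :: "'x measure"
    proof -
      interpret L: prob_space L using L by (simp add: borel_prob_def)
      have [measurable_cong]: "sets L = sets borel" using L by (simp add: borel_prob_def)
      have [measurable]: "C \<in> sets borel" using C by simp
      have [measurable]: "f n \<in> borel_measurable L" for n
        using borel_measurable_continuous_onI[OF cont] by measurable
      have "(\<lambda>n. \<integral>x. f n x \<partial>L) \<longlonglongrightarrow> (\<integral>x. indicator C x \<partial>L)"
        by (rule integral_dominated_convergence[where w = "\<lambda>_. 1"]) (use range lim in auto)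
      then show ?thesis by simp
    qed
    have "measure M C = measure N C"
      using conv[OF M] conv[OF N] eq[OF cont range] LIMSEQ_unique by simp
    then show ?thesis by (simp add: M.emeasure_eq_measure N.emeasure_eq_measure)
  qed simp
qed (use M in \<open>auto simp: borel_prob_def prob_space.emeasure_le_1 dest: prob_space.finite_measure finite_measure.emeasure_finite\<close>)

section \<open>Weak-* sequential compactness by coding into the real line\<close>

text \<open>A first disagreement at digit \<open>i\<close> moves the value by
  \<open>(1/3) ^ i\<close>, while all later digits together can undo at most half of that. Base
  three with digits 0 and 1 leaves this gap; base two would not.\<close>

lemma ternary_digits_agree:
  fixes a b :: "nat \<Rightarrow> bool"
  assumes close: "\<bar>(\<Sum>i. of_bool (a i) * (1/3) ^ i) - (\<Sum>i. of_bool (b i) * (1/3) ^ i)\<bar> < (1/3::real) ^ k / 2"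
    and "i \<le> k"
  shows "a i = b i"
  using \<open>i \<le> k\<close>
proof (induction i rule: less_induct)
  case (less i)
  define d :: "nat \<Rightarrow> real" where "d j = (of_bool (a j) - of_bool (b j)) * (1/3) ^ j" for j
  have summ: "summable (\<lambda>i. of_bool (c i) * (1/3::real) ^ i)" for c :: "nat \<Rightarrow> bool"
    by (rule summable_comparison_test[OF _ summable_geometric[of "1/3"]]) (auto intro!: exI[of _ 0])
  have d_le: "\<bar>d j\<bar> \<le> (1/3) ^ j" for j by (auto simp: d_def)
  have sd: "summable d"
    unfolding d_def left_diff_distrib by (intro summable_diff summ)
  have tail_geo: "(\<lambda>j. (1/3::real) ^ (j + Suc i)) sums ((1/3) ^ i / 2)"
    using sums_mult[OF geometric_sums[of "1/3::real"], of "(1/3) ^ Suc i"]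
    by (simp add: power_add mult_ac)
  have "norm (\<Sum>j. d (j + Suc i)) \<le> (\<Sum>j. (1/3::real) ^ (j + Suc i))"
    by (rule norm_suminf_le) (use tail_geo d_le in \<open>auto simp: sums_iff simp del: power_Suc\<close>)
  then have tail: "\<bar>\<Sum>j. d (j + Suc i)\<bar> \<le> (1/3) ^ i / 2"
    using tail_geo by (simp add: sums_iff)
  \<comment> \<open>By the induction hypothesis all earlier digits cancel.\<close>
  have init: "(\<Sum>j<Suc i. d j) = d i"
    using less by (simp add: d_def)
  have "(\<Sum>j. d j) = d i + (\<Sum>j. d (j + Suc i))"
    using suminf_split_initial_segment[OF sd, of "Suc i"] init by simp
  moreover have "(\<Sum>j. d j) = (\<Sum>i. of_bool (a i) * (1/3) ^ i) - (\<Sum>i. of_bool (b i) * (1/3) ^ i)"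
    unfolding d_def left_diff_distrib by (intro suminf_diff[symmetric] summ)
  moreover have "(1/3::real) ^ k / 2 \<le> (1/3) ^ i / 2"
    using less.prems by (simp add: power_decreasing)
  ultimately have "\<bar>d i\<bar> < (1/3) ^ i"
    using close tail by linarith
  then show ?case by (cases "a i"; cases "b i") (auto simp: d_def)
qed

text \<open>
  The ternary code of a point records its membership in a countable family of balls. It is only Borel,
  but its inverse is uniformly continuous, so it transports weak convergence on the line back to \<open>'x\<close>.
\<close>

lemma borel_code_into_reals:
  obtains s :: "'x::compact_metric_space \<Rightarrow> real"
  where "s \<in> borel_measurable borel" "\<And>x. 0 \<le> s x \<and> s x \<le> 3/2"
    "\<And>e. 0 < e \<Longrightarrow> \<exists>\<delta>>0. \<forall>x y. \<bar>s x - s y\<bar> < \<delta> \<longrightarrow> dist x y < e"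
proof -
  obtain D :: "'x set" where D: "countable D" "\<And>X. open X \<Longrightarrow> X \<noteq> {} \<Longrightarrow> \<exists>d\<in>D. d \<in> X"
    using countable_dense_exists by blast
  then have "D \<noteq> {}" using open_UNIV by blast
  define p where "p = from_nat_into D"
  have p: "range p = D" unfolding p_def using \<open>D \<noteq> {}\<close> D(1) by simp
  define B where "B i = (case prod_decode i of (a, n) \<Rightarrow> ball (p a) (1 / Suc n))" for i
  have B_sets[measurable]: "B i \<in> sets borel" for i
    by (auto simp: B_def split: prod.split)
  define s :: "'x \<Rightarrow> real" where "s x = (\<Sum>i. of_bool (x \<in> B i) * (1/3) ^ i)" for x
  have summ: "summable (\<lambda>i. of_bool (x \<in> B i) * (1/3::real) ^ i)" for x
    by (rule summable_comparison_test[OF _ summable_geometric[of "1/3"]]) (auto intro!: exI[of _ 0])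
  have "s \<in> borel_measurable borel"
    unfolding s_def[abs_def] of_bool_def by measurable
  moreover have "0 \<le> s x \<and> s x \<le> 3/2" for x
  proof
    show "0 \<le> s x" unfolding s_def by (intro suminf_nonneg summ) auto
    have "s x \<le> (\<Sum>i. (1/3) ^ i)" unfolding s_def by (intro suminf_le summ summable_geometric) auto
    then show "s x \<le> 3/2" by (simp add: suminf_geometric)
  qed
  moreover have "\<exists>\<delta>>0. \<forall>x y. \<bar>s x - s y\<bar> < \<delta> \<longrightarrow> dist x y < e" if e: "0 < e" for e
  proof -
    obtain n where n: "1 / Suc n < e / 2"
      using nat_approx_posE[of "e / 2"] e by auto
    have "UNIV \<subseteq> (\<Union>a. ball (p a) (1 / Suc n))"
    proof
      fix x :: 'x
      obtain d where d: "d \<in> D" "d \<in> ball x (1 / Suc n)"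
        using D(2)[of "ball x (1 / Suc n)"] by auto
      with p obtain a where "d = p a" by blast
      with d show "x \<in> (\<Union>a. ball (p a) (1 / Suc n))" by (auto simp: dist_commute)
    qed
    then obtain F where F: "finite F" "UNIV \<subseteq> (\<Union>a\<in>F. ball (p a) (1 / Suc n))"
      using compactE_image[OF compact_UNIV, of UNIV "\<lambda>a. ball (p a) (1 / Suc n)"] by (metis open_ball subset_UNIV)
    \<comment> \<open>Finitely many balls of radius \<open>1 / Suc n\<close> cover the space, so
      agreement of the codes up to the largest of their indices puts both points into a common
      ball.\<close>
    obtain k where k: "\<And>a. a \<in> F \<Longrightarrow> prod_encode (a, n) \<le> k"
      using F(1) by (auto intro!: that[of "Max ((\<lambda>a. prod_encode (a, n)) ` F)"])
    have "dist x y < e" if "\<bar>s x - s y\<bar> < (1/3) ^ k / 2" for x y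
    proof -
      obtain a where a: "a \<in> F" "x \<in> ball (p a) (1 / Suc n)" using F(2) by blast
      have "x \<in> B (prod_encode (a, n)) \<longleftrightarrow> y \<in> B (prod_encode (a, n))"
        using ternary_digits_agree[where a = "\<lambda>i. x \<in> B i" and b = "\<lambda>i. y \<in> B i", OF _ k[OF a(1)]] that
        unfolding s_def by blast
      with a have "dist (p a) x < 1 / Suc n" "dist (p a) y < 1 / Suc n" by (auto simp: B_def)
      with n show ?thesis using dist_triangle3[of x y "p a"] by linarith
    qed
    then show ?thesis by (intro exI[of _ "(1/3) ^ k / 2"]) auto
  qed
  ultimately show thesis by (rule that)
qed

text \<open>Push the measures to the line by the code, select a convergent subsequence there by
  Helly's theorem, and pull the limit back by the extension of the inverse code to the closure
  \<open>K\<close> of its range. Tightness is automatic because the codes are bounded.\<close>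

lemma weak_star_subsequence:
  fixes M :: "nat \<Rightarrow> 'x::compact_metric_space measure"
  assumes M: "\<And>n. borel_prob (M n)"
  obtains r N where "strict_mono r" "borel_prob N" "weak_star_lim (M \<circ> r) N"
proof -
  obtain s :: "'x \<Rightarrow> real" where s[measurable]: "s \<in> borel_measurable borel"
    and s_range: "\<And>x. 0 \<le> s x \<and> s x \<le> 3/2"
    and s_inv: "\<And>e. 0 < e \<Longrightarrow> \<exists>\<delta>>0. \<forall>x y. \<bar>s x - s y\<bar> < \<delta> \<longrightarrow> dist x y < e"
    by (rule borel_code_into_reals) blast
  have s_inj: "x = y" if "s x = s y" for x y
  proof (rule ccontr)
    assume "x \<noteq> y"
    then obtain \<delta> where "\<delta> > 0" "\<And>u v. \<bar>s u - s v\<bar> < \<delta> \<Longrightarrow> dist u v < dist x y"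
      using s_inv[of "dist x y"] by auto
    from this(2)[of x y] show False using \<open>\<delta> > 0\<close> that by simp
  qed
  then have inj: "inj s" by (auto simp: inj_def)
  have "uniformly_continuous_on (range s) (inv s)"
    unfolding uniformly_continuous_on_def
  proof (intro allI impI)
    fix e :: real assume "0 < e"
    from s_inv[OF this] obtain \<delta> where \<delta>: "\<delta> > 0" "\<And>x y. \<bar>s x - s y\<bar> < \<delta> \<Longrightarrow> dist x y < e" by blast
    show "\<exists>d>0. \<forall>x\<in>range s. \<forall>x'\<in>range s. dist x' x < d \<longrightarrow> dist (inv s x') (inv s x) < e"
      using \<delta> by (intro exI[of _ \<delta>]) (auto simp: dist_real_def inv_f_f[OF inj])
  qed
  \<comment> \<open>Uniform continuity and completeness of the target extend the inverse code to
    \<open>K\<close>, which may contain points that are not codes.\<close>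
  then obtain \<pi> where \<pi>: "uniformly_continuous_on (closure (range s)) \<pi>" "\<And>t. t \<in> range s \<Longrightarrow> inv s t = \<pi> t"
    by (rule uniformly_continuous_on_extension_on_closure) blast
  have \<pi>_s: "\<pi> (s x) = x" for x using \<pi>(2)[of "s x"] inv_f_f[OF inj] by simp
  define K where "K = closure (range s)"
  have K: "closed K" "s x \<in> K" "K \<noteq> {}" for x
    unfolding K_def using closure_subset[of "range s"] by auto
  have \<pi>_cont: "continuous_on K \<pi>"
    using \<pi>(1) unfolding K_def by (rule uniformly_continuous_imp_continuous)

  have prob: "prob_space (M n)" and sets_M[measurable_cong]: "sets (M n) = sets borel" for n
    using M[of n] by (simp_all add: borel_prob_def)
  define L where "L n = distr (M n) borel s" for n
  have L: "real_distribution (L n)" for n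
    unfolding L_def by (intro prob_space.real_distribution_distr prob) simp
  have "tight L"
    unfolding tight_def
  proof (intro conjI allI impI)
    fix \<epsilon> :: real assume "0 < \<epsilon>"
    \<comment> \<open>All codes lie in [0, 3/2], inside this half-open interval.\<close>
    have "measure (L n) {-1<..2} = 1" for n
    proof -
      have le: "s x \<le> 3/2" for x using s_range by blast
      have "s -` {-1<..2} = UNIV"
        using le[THEN order_trans] order_less_le_trans[OF _ s_range[THEN conjunct1]] by auto
      then show ?thesis
        unfolding L_def using prob_space.prob_space[OF prob, of n]
        by (subst measure_distr) (simp_all add: sets_eq_imp_space_eq[OF sets_M])
    qed
    then show "\<exists>a b. a < b \<and> (\<forall>n. 1 - \<epsilon> < measure (L n) {a<..b})"
      using \<open>0 < \<epsilon>\<close> by (intro exI[of _ "-1"] exI[of _ 2]) simp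
  qed (rule L)
  then obtain r Q where r: "strict_mono r" and Q: "real_distribution Q" and LQ: "weak_conv_m (L \<circ> id \<circ> r) Q"
    using tight_imp_convergent_subsubsequence[of L id] by (auto simp: strict_mono_id)
  interpret Q: real_distribution Q by fact
  have conv: "(\<lambda>n. \<integral>x. F (s x) \<partial>M (r n)) \<longlonglongrightarrow> (\<integral>t. F t \<partial>Q)"
    if F: "continuous_on UNIV F" "\<And>t. \<bar>F t\<bar> \<le> B" for F :: "real \<Rightarrow> real" and B
  proof -
    have [measurable]: "F \<in> borel_measurable borel"
      using F(1) by (rule borel_measurable_continuous_onI)
    have "(\<lambda>n. integral\<^sup>L ((L \<circ> id \<circ> r) n) F) \<longlonglongrightarrow> integral\<^sup>L Q F"
      by (rule weak_conv_imp_integral_bdd_continuous_conv[where B = B])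
         (use L Q LQ F in \<open>auto simp: comp_def continuous_on_eq_continuous_at\<close>)
    then show ?thesis by (simp add: L_def integral_distr)
  qed
  \<comment> \<open>The limit law lives on \<open>K\<close>: a bounded continuous function that
    vanishes exactly on \<open>K\<close> has integral 0 under every coded measure, hence under the
    limit.\<close>
  have AE_K: "AE t in Q. t \<in> K"
  proof -
    define F where "F t = min 1 (infdist t K)" for t
    have F_cont: "continuous_on UNIV F" unfolding F_def by (intro continuous_intros)
    then have [measurable]: "F \<in> borel_measurable borel" by (rule borel_measurable_continuous_onI)
    have F_range: "\<bar>F t\<bar> \<le> 1" "0 \<le> F t" for t unfolding F_def by (auto simp: infdist_nonneg)
    have "F (s x) = 0" for x by (simp add: F_def K)
    then have "(\<integral>t. F t \<partial>Q) = 0"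
      using conv[OF F_cont F_range(1)] by (simp add: LIMSEQ_const_iff)
    moreover have "integrable Q F"
      using F_range by (intro Q.integrable_const_bound[where B = 1]) auto
    ultimately have "AE t in Q. F t = 0"
      using F_range by (subst (asm) integral_nonneg_eq_0_iff_AE) auto
    then show ?thesis
      by eventually_elim (use K in \<open>auto simp: F_def min_def in_closed_iff_infdist_zero split: if_splits\<close>)
  qed
  \<comment> \<open>The value off \<open>K\<close> is taken only on a \<open>Q\<close>-null set; it
    serves to make the map Borel on the whole line.\<close>
  define \<pi>' where "\<pi>' t = (if t \<in> K then \<pi> t else undefined)" for t
  have [measurable]: "\<pi>' \<in> borel_measurable borel"
    unfolding \<pi>'_def using K(1) \<pi>_cont
    by (intro borel_measurable_continuous_on_if) auto
  define N where "N = distr Q borel \<pi>'"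
  have "borel_prob N"
    unfolding N_def borel_prob_def by (auto intro: Q.prob_space_distr)
  moreover have "weak_star_lim (M \<circ> r) N"
    unfolding weak_star_lim_def
  proof (intro allI impI)
    fix f :: "'x \<Rightarrow> real" assume f: "continuous_on UNIV f"
    then have [measurable]: "f \<in> borel_measurable borel" by (rule borel_measurable_continuous_onI)
    obtain B where B: "0 < B" "\<And>x. \<bar>f x\<bar> \<le> B" using continuous_real_bounded[OF f] by blast
    have "continuous_on K (\<lambda>t. f (\<pi> t))"
      by (rule continuous_on_compose2[OF f \<pi>_cont]) auto
    \<comment> \<open>\<open>f \<circ> \<pi>\<close> is controlled only on \<open>K\<close>;
      Tietze's theorem extends it with the same bound to the line, where \<open>conv\<close>
      applies.\<close>
    then obtain F where F: "continuous_on UNIV F" "\<And>t. t \<in> K \<Longrightarrow> F t = f (\<pi> t)" "\<And>t. \<bar>F t\<bar> \<le> B"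
      using Tietze[of K "\<lambda>t. f (\<pi> t)" UNIV B] K(1) B by (auto simp: less_imp_le)
    from F(1) have [measurable]: "F \<in> borel_measurable borel" by (rule borel_measurable_continuous_onI)
    have "(\<integral>x. f x \<partial>N) = (\<integral>t. f (\<pi>' t) \<partial>Q)" unfolding N_def by (simp add: integral_distr)
    also have "\<dots> = (\<integral>t. F t \<partial>Q)"
    proof (rule integral_cong_AE)
      show "AE t in Q. f (\<pi>' t) = F t"
        using AE_K by eventually_elim (simp add: \<pi>'_def F)
    qed simp_all
    finally show "(\<lambda>n. \<integral>x. f x \<partial>(M \<circ> r) n) \<longlonglongrightarrow> (\<integral>x. f x \<partial>N)"
      using conv[OF F(1,3)] by (simp add: F(2) K \<pi>_s)
  qed
  ultimately show thesis using r that by blast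
qed

section \<open>Integrals of bounded functions\<close>

lemma continuous_on_integral_bounded:
  fixes f :: "'x::metric_space \<Rightarrow> 's \<Rightarrow> real"
  assumes "finite_measure M"
    and meas: "\<And>x. f x \<in> borel_measurable M"
    and cont: "\<And>s. s \<in> space M \<Longrightarrow> continuous_on UNIV (\<lambda>x. f x s)"
    and bound: "\<And>x s. \<bar>f x s\<bar> \<le> B"
  shows "continuous_on UNIV (\<lambda>x. \<integral>s. f x s \<partial>M)"
proof -
  interpret finite_measure M by fact
  have "(\<lambda>n. \<integral>s. f (u n) s \<partial>M) \<longlonglongrightarrow> (\<integral>s. f x s \<partial>M)" if "u \<longlonglongrightarrow> x" for u x
  proof (rule integral_dominated_convergence[where w = "\<lambda>_. B"])
    show "AE s in M. (\<lambda>n. f (u n) s) \<longlonglongrightarrow> f x s"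
      using cont that by (auto simp: continuous_on_sequentially comp_def)
  qed (use meas bound in auto)
  then show ?thesis
    by (auto simp: continuous_on_sequentially comp_def)
qed

text \<open>Uniform continuity handles close pairs, and the trivial bound \<open>2 * B\<close>
  handles pairs at distance at least \<open>\<delta>\<close>. The affine modulus turns bounds on
  mean distances into bounds on differences of integrals of \<open>f\<close>.\<close>

lemma continuous_dist_modulus:
  fixes f :: "'x::compact_metric_space \<Rightarrow> real"
  assumes f: "continuous_on UNIV f" and "0 < \<epsilon>"
  obtains C where "0 < C" "\<And>u v. \<bar>f u - f v\<bar> \<le> \<epsilon> + C * dist u v"
proof -
  obtain B where B: "0 < B" "\<And>x. \<bar>f x\<bar> \<le> B" using continuous_real_bounded[OF f] by blast
  have "uniformly_continuous_on UNIV f"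
    using f compact_UNIV by (rule compact_uniformly_continuous)
  then obtain \<delta> where \<delta>: "\<delta> > 0" "\<And>u v. dist u v < \<delta> \<Longrightarrow> dist (f u) (f v) < \<epsilon>"
    using \<open>0 < \<epsilon>\<close> unfolding uniformly_continuous_on_def by (metis UNIV_I)
  show thesis
  proof (rule that[of "2 * B / \<delta>"])
    show "0 < 2 * B / \<delta>" using B \<delta> by simp
    fix u v
    show "\<bar>f u - f v\<bar> \<le> \<epsilon> + 2 * B / \<delta> * dist u v"
    proof (cases "dist u v < \<delta>")
      case True
      have "0 \<le> 2 * B / \<delta> * dist u v" using B \<delta> by simp
      with \<delta>(2)[OF True] show ?thesis by (simp add: dist_real_def)
    next
      case False
      have "\<bar>f u - f v\<bar> \<le> 2 * B" using B(2)[of u] B(2)[of v] by linarith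
      also have "\<dots> \<le> 2 * B / \<delta> * dist u v"
        using False B \<delta> by (simp add: field_simps)
      finally show ?thesis using \<open>0 < \<epsilon>\<close> by linarith
    qed
  qed
qed

lemma integrable_bounded:
  fixes f :: "'a \<Rightarrow> real"
  assumes "prob_space M" "f \<in> borel_measurable M" "\<And>x. \<bar>f x\<bar> \<le> B"
  shows "integrable M f"
  using assms by (auto intro!: finite_measure.integrable_const_bound[where B = B] simp: prob_space_def)

lemma abs_integral_bounded:
  fixes f :: "'a \<Rightarrow> real"
  assumes "prob_space M" "\<And>x. \<bar>f x\<bar> \<le> B"
  shows "\<bar>\<integral>x. f x \<partial>M\<bar> \<le> B"
proof (cases "f \<in> borel_measurable M")
  case True
  interpret prob_space M by fact
  have "\<bar>\<integral>x. f x \<partial>M\<bar> \<le> (\<integral>x. \<bar>f x\<bar> \<partial>M)" by (rule integral_abs_bound)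
  also have "\<dots> \<le> (\<integral>x. B \<partial>M)"
    using True assms(2) by (intro integral_mono integrable_bounded[where B = B] assms(1)) (auto intro: abs_ge_zero[THEN order_trans])
  finally show ?thesis by (simp add: prob_space)
next
  \<comment> \<open>Without measurability the integral has its default value 0, and \<open>B\<close>
    is nonnegative because it bounds an absolute value.\<close>
  case False
  then have "(\<integral>x. f x \<partial>M) = 0"
    by (intro not_integrable_integral_eq) auto
  moreover have "0 \<le> B" using assms(2)[of undefined] by linarith
  ultimately show ?thesis by simp
qed

lemma Fubini_bounded:
  fixes f :: "'a \<Rightarrow> 'b \<Rightarrow> real"
  assumes M: "prob_space M" and N: "prob_space N"
    and [measurable]: "case_prod f \<in> borel_measurable (M \<Otimes>\<^sub>M N)"
    and bound: "\<And>x y. \<bar>f x y\<bar> \<le> B"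
  shows "(\<integral>x. \<integral>y. f x y \<partial>N \<partial>M) = (\<integral>z. case_prod f z \<partial>(M \<Otimes>\<^sub>M N))"
    and "(\<integral>y. \<integral>x. f x y \<partial>M \<partial>N) = (\<integral>x. \<integral>y. f x y \<partial>N \<partial>M)"
proof -
  interpret M: prob_space M by fact
  interpret N: prob_space N by fact
  interpret pair_prob_space M N ..
  have "integrable (M \<Otimes>\<^sub>M N) (case_prod f)"
    using bound by (intro integrable_bounded[where B = B]) (auto intro: prob_space_axioms)
  then show "(\<integral>x. \<integral>y. f x y \<partial>N \<partial>M) = (\<integral>z. case_prod f z \<partial>(M \<Otimes>\<^sub>M N))"
    "(\<integral>y. \<integral>x. f x y \<partial>M \<partial>N) = (\<integral>x. \<integral>y. f x y \<partial>N \<partial>M)"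
    using integral_fst[of f] Fubini_integral[of f] by simp_all
qed

section \<open>The random walk and its law\<close>

locale random_action =
  fixes m :: "'g::{topological_group_add, second_countable_topology} measure"
    and act :: "'g \<Rightarrow> 'x::compact_metric_space \<Rightarrow> 'x"
  assumes borel_prob_m: "borel_prob m"
    and continuous_act: "continuous_action act"
begin

lemma prob_space_m: "prob_space m" and sets_m[measurable_cong]: "sets m = sets borel"
  using borel_prob_m by (simp_all add: borel_prob_def)

lemma space_m[simp]: "space m = UNIV"
  using sets_eq_imp_space_eq[OF sets_m] by simp

sublocale m: prob_space m
  by (rule prob_space_m)

text \<open>\<open>S\<close> is from here on the product measure on sequences of letters, and
  \<open>comb_seq i \<omega> \<omega>'\<close> follows \<open>\<omega>\<close> for \<open>i\<close>
  letters and then starts \<open>\<omega>'\<close>.\<close>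

sublocale sequence_space m ..

lemma act_plus: "act (g + h) x = act g (act h x)"
  using continuous_act by (simp add: continuous_action_def)

lemma continuous_on_act: "continuous_on A f \<Longrightarrow> continuous_on A h \<Longrightarrow> continuous_on A (\<lambda>z. act (f z) (h z))"
  using continuous_act continuous_on_compose2[of UNIV "\<lambda>(g, x). act g x" A "\<lambda>z. (f z, h z)"]
  by (auto simp: continuous_action_def intro: continuous_on_Pair)

lemma act_measurable[measurable (raw)]:
  assumes [measurable]: "f \<in> borel_measurable M" "h \<in> borel_measurable M"
  shows "(\<lambda>z. act (f z) (h z)) \<in> borel_measurable M"
proof -
  \<comment> \<open>Second countability of both spaces makes the Borel sets of the product the
    product of the Borel sets, so joint continuity yields joint measurability.\<close>
  have "(\<lambda>(g, x). act g x) \<in> borel_measurable (borel \<Otimes>\<^sub>M borel)"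
    unfolding borel_prod using continuous_act
    by (intro borel_measurable_continuous_onI) (simp add: continuous_action_def)
  then have [measurable]: "(\<lambda>z. act (fst z) (snd z)) \<in> borel_measurable (borel \<Otimes>\<^sub>M borel)"
    by (simp add: case_prod_beta')
  have "(\<lambda>z. act (fst (f z, h z)) (snd (f z, h z))) \<in> borel_measurable M"
    by measurable
  then show ?thesis by simp
qed

definition walk :: "nat \<Rightarrow> (nat \<Rightarrow> 'g) \<Rightarrow> 'g" where
  "walk n \<omega> = sum_list (map \<omega> [0..<n])"

lemma walk_0[simp]: "walk 0 \<omega> = 0"
  and walk_Suc: "walk (Suc n) \<omega> = walk n \<omega> + \<omega> n"
  by (simp_all add: walk_def)

lemma walk_measurable[measurable]: "walk n \<in> borel_measurable S"
proof (induction n)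
  case (Suc n)
  note [measurable] = Suc
  have [measurable]: "(\<lambda>\<omega>. \<omega> n) \<in> borel_measurable S"
    using measurable_component_singleton[of n UNIV "\<lambda>_. m"] by (simp cong: measurable_cong_sets add: sets_m)
  show ?case unfolding walk_Suc by measurable
qed simp

text \<open>New letters are appended on the right, but a letter put in front of the sequence
  multiplies on the left. This second form matches \<open>conv_power\<close>.\<close>

lemma walk_case_nat: "walk (Suc n) (case_nat h \<omega>) = h + walk n \<omega>"
  by (induction n) (simp_all add: walk_Suc add.assoc)

text \<open>The algebra behind the Markov property: after time \<open>i\<close> the walk continues
  from \<open>walk i \<omega>\<close> with a fresh sequence.\<close>

lemma walk_comb_seq: "walk (i + k) (comb_seq i \<omega> \<omega>') = walk i \<omega> + walk k \<omega>'"
proof (induction k)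
  case 0
  have "map (comb_seq i \<omega> \<omega>') [0..<i] = map \<omega> [0..<i]"
    by (simp add: comb_seq_less)
  then show ?case unfolding walk_def by (simp only: add_0_right) simp
next
  case (Suc k)
  then show ?case using comb_seq_add[of i \<omega> \<omega>' k] by (simp add: walk_Suc add.assoc add.commute)
qed

lemma prob_space_S: "prob_space S"
  by (rule P.prob_space_axioms)

text \<open>The induction splits off the first letter rather than the last, since
  \<open>conv_power\<close> multiplies by \<open>m\<close> on the left; prefixing an independent
  letter of law \<open>m\<close> preserves the product measure.\<close>

lemma distr_walk: "distr S borel (walk n) = conv_power m n"
proof (induction n)
  case 0
  show ?case
  proof (rule measure_eqI)
    fix A assume "A \<in> sets (distr S borel (walk 0))"
    then show "emeasure (distr S borel (walk 0)) A = emeasure (conv_power m 0) A"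
      using prob_space.emeasure_space_1[OF prob_space_S]
      by (auto simp: emeasure_distr walk_def[abs_def] indicator_def)
  qed simp
next
  case (Suc n)
  have "distr S borel (walk (Suc n)) = distr (distr (m \<Otimes>\<^sub>M S) S (\<lambda>(h, \<omega>). case_nat h \<omega>)) borel (walk (Suc n))"
    by (simp only: PiM_iter)
  also have "\<dots> = distr (m \<Otimes>\<^sub>M S) borel (\<lambda>(h, \<omega>). h + walk n \<omega>)"
    by (subst distr_distr) (auto simp: comp_def case_prod_beta' walk_case_nat)
  also have "\<dots> = distr (distr (m \<Otimes>\<^sub>M S) (m \<Otimes>\<^sub>M borel) (\<lambda>(h, \<omega>). (h, walk n \<omega>))) borel (\<lambda>(h, g). h + g)"
    by (subst distr_distr) (auto simp: comp_def case_prod_beta')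
  also have "distr (m \<Otimes>\<^sub>M S) (m \<Otimes>\<^sub>M borel) (\<lambda>(h, \<omega>). (h, walk n \<omega>)) = distr m m (\<lambda>h. h) \<Otimes>\<^sub>M distr S borel (walk n)"
  proof (rule pair_measure_distr[symmetric])
    interpret d: prob_space "distr S borel (walk n)"
      by (rule prob_space.prob_space_distr[OF prob_space_S]) measurable
    show "sigma_finite_measure (distr S borel (walk n))" ..
  qed auto
  finally show ?case using Suc by (simp add: conv_def distr_id2)
qed

lemma measure_conv_power:
  assumes "A \<in> sets borel"
  shows "measure (conv_power m n) A = measure S {\<omega>. walk n \<omega> \<in> A}"
  unfolding distr_walk[symmetric] using assms
  by (subst measure_distr) (auto simp: vimage_def space_PiM)

lemma integral_first_step:
  fixes G :: "(nat \<Rightarrow> 'g) \<Rightarrow> real"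
  assumes [measurable]: "G \<in> borel_measurable S" and bound: "\<And>\<omega>. \<bar>G \<omega>\<bar> \<le> B"
  shows "(\<integral>\<omega>. G \<omega> \<partial>S) = (\<integral>h. \<integral>\<omega>. G (case_nat h \<omega>) \<partial>S \<partial>m)"
proof -
  have "(\<integral>\<omega>. G \<omega> \<partial>S) = (\<integral>\<omega>. G \<omega> \<partial>distr (m \<Otimes>\<^sub>M S) S (\<lambda>(h, \<omega>). case_nat h \<omega>))"
    by (simp only: PiM_iter)
  also have "\<dots> = (\<integral>z. (\<lambda>(h, \<omega>). G (case_nat h \<omega>)) z \<partial>(m \<Otimes>\<^sub>M S))"
    by (subst integral_distr) (auto simp: case_prod_beta')
  also have "\<dots> = (\<integral>h. \<integral>\<omega>. G (case_nat h \<omega>) \<partial>S \<partial>m)"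
    by (rule Fubini_bounded(1)[symmetric, where B = B]) (auto intro: prob_space_m prob_space_S bound)
  finally show ?thesis .
qed

text \<open>The first \<open>i\<close> letters are independent of the rest; with
  \<open>walk_comb_seq\<close> this is the Markov property at time \<open>i\<close>.\<close>

lemma integral_split_at:
  fixes G :: "(nat \<Rightarrow> 'g) \<Rightarrow> real"
  assumes [measurable]: "G \<in> borel_measurable S" and bound: "\<And>\<omega>. \<bar>G \<omega>\<bar> \<le> B"
  shows "(\<integral>\<omega>. G \<omega> \<partial>S) = (\<integral>\<omega>. \<integral>\<omega>'. G (comb_seq i \<omega> \<omega>') \<partial>S \<partial>S)"
proof -
  have "(\<integral>\<omega>. G \<omega> \<partial>S) = (\<integral>\<omega>. G \<omega> \<partial>distr (S \<Otimes>\<^sub>M S) S (\<lambda>(\<omega>, \<omega>'). comb_seq i \<omega> \<omega>'))"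
    by (simp only: PiM_comb_seq)
  also have "\<dots> = (\<integral>z. (\<lambda>(\<omega>, \<omega>'). G (comb_seq i \<omega> \<omega>')) z \<partial>(S \<Otimes>\<^sub>M S))"
    by (subst integral_distr) (auto simp: case_prod_beta')
  also have "\<dots> = (\<integral>\<omega>. \<integral>\<omega>'. G (comb_seq i \<omega> \<omega>') \<partial>S \<partial>S)"
    by (rule Fubini_bounded(1)[symmetric, where B = B]) (auto intro: prob_space_S bound)
  finally show ?thesis .
qed

lemma expectation_walk_Suc:
  fixes F :: "'g \<Rightarrow> real"
  assumes [measurable]: "F \<in> borel_measurable borel" and bound: "\<And>g. \<bar>F g\<bar> \<le> B"
  shows "(\<integral>\<omega>. F (walk (Suc n) \<omega>) \<partial>S) = (\<integral>h. \<integral>\<omega>. F (h + walk n \<omega>) \<partial>S \<partial>m)"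
  using bound by (subst integral_first_step[where B = B]) (auto simp: walk_case_nat)

lemma expectation_walk_add:
  fixes F :: "'g \<Rightarrow> real"
  assumes [measurable]: "F \<in> borel_measurable borel" and bound: "\<And>g. \<bar>F g\<bar> \<le> B"
  shows "(\<integral>\<omega>. F (walk (i + k) \<omega>) \<partial>S) = (\<integral>\<omega>. \<integral>\<omega>'. F (walk i \<omega> + walk k \<omega>') \<partial>S \<partial>S)"
  using bound by (subst integral_split_at[where B = B and i = i]) (auto simp: walk_comb_seq)

section \<open>Stationary measures and occupation measures\<close>

lemma stationaryD:
  assumes "stationary m act \<nu>"
  shows "prob_space \<nu>" "sets \<nu> = sets borel"
  using assms by (auto simp: stationary_def borel_prob_def)

lemma integral_conv:
  fixes f :: "'x \<Rightarrow> real"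
  assumes \<nu>: "borel_prob \<nu>"
    and [measurable]: "f \<in> borel_measurable borel" and bound: "\<And>x. \<bar>f x\<bar> \<le> B"
  shows "(\<integral>x. f x \<partial>conv act m \<nu>) = (\<integral>h. \<integral>x. f (act h x) \<partial>\<nu> \<partial>m)"
proof -
  have [measurable_cong]: "sets \<nu> = sets borel" and prob: "prob_space \<nu>"
    using \<nu> by (auto simp: borel_prob_def)
  have "(\<integral>x. f x \<partial>conv act m \<nu>) = (\<integral>z. (\<lambda>(h, x). f (act h x)) z \<partial>(m \<Otimes>\<^sub>M \<nu>))"
    unfolding conv_def by (subst integral_distr) (auto simp: case_prod_beta')
  also have "\<dots> = (\<integral>h. \<integral>x. f (act h x) \<partial>\<nu> \<partial>m)"
    by (rule Fubini_bounded(1)[symmetric, where B = B]) (auto intro: prob_space_m prob bound)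
  finally show ?thesis .
qed

text \<open>Induction on \<open>n\<close> for all \<open>f\<close> at once: with the first letter
  \<open>h\<close> fixed, the hypothesis for \<open>f \<circ> act h\<close> removes the other
  letters, and stationarity then removes \<open>h\<close>.\<close>

lemma integral_stationary_walk:
  fixes f :: "'x \<Rightarrow> real"
  assumes \<nu>: "stationary m act \<nu>"
    and "f \<in> borel_measurable borel" and "\<And>x. \<bar>f x\<bar> \<le> B"
  shows "(\<integral>\<omega>. \<integral>x. f (act (walk n \<omega>) x) \<partial>\<nu> \<partial>S) = (\<integral>x. f x \<partial>\<nu>)"
  using assms(2,3)
proof (induction n arbitrary: f)
  case 0
  then show ?case
    using continuous_act prob_space.prob_space[OF prob_space_S] by (simp add: continuous_action_def)
next
  case (Suc n)
  note [measurable] = Suc.prems(1)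
  note [measurable_cong] = stationaryD(2)[OF \<nu>]
  note prob = stationaryD(1)[OF \<nu>]
  interpret \<nu>: prob_space \<nu> by fact
  have "(\<integral>\<omega>. \<integral>x. f (act (walk (Suc n) \<omega>) x) \<partial>\<nu> \<partial>S)
      = (\<integral>h. \<integral>\<omega>. \<integral>x. f (act h (act (walk n \<omega>) x)) \<partial>\<nu> \<partial>S \<partial>m)"
    using Suc.prems by (subst expectation_walk_Suc[where B = B])
      (auto simp: act_plus intro!: abs_integral_bounded prob)
  also have "\<dots> = (\<integral>h. \<integral>x. f (act h x) \<partial>\<nu> \<partial>m)"
    using Suc.prems(2) by (subst Suc.IH[of "\<lambda>x. f (act _ x)"]) simp_all
  also have "\<dots> = (\<integral>x. f x \<partial>conv act m \<nu>)"
    using \<nu> Suc.prems by (subst integral_conv[where B = B]) (auto simp: stationary_def)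
  finally show ?case using \<nu> by (simp add: stationary_def)
qed

text \<open>This is \<open>m_n\<close> convolved with the point mass at \<open>x\<close>, realised
  as the law of \<open>act (walk j \<omega>) x\<close> at an independent uniform time
  \<open>j\<close>. It is meaningful for \<open>n > 0\<close>, which is why limits are taken along
  \<open>Suc\<close>.\<close>

definition occupation :: "nat \<Rightarrow> 'x \<Rightarrow> 'x measure" where
  "occupation n x = distr (measure_pmf (pmf_of_set {1..n}) \<Otimes>\<^sub>M S) borel (\<lambda>(j, \<omega>). act (walk j \<omega>) x)"

lemma occupation_measurable:
  "(\<lambda>(j, \<omega>). act (walk j \<omega>) x) \<in> borel_measurable (measure_pmf p \<Otimes>\<^sub>M S)"
proof -
  \<comment> \<open>The time coordinate is countable, so measurability in \<open>\<omega>\<close> at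
    each fixed time is enough.\<close>
  have "(\<lambda>z. act (walk (fst z) (snd z)) x) \<in> borel_measurable (count_space UNIV \<Otimes>\<^sub>M S)"
    by (rule measurable_pair_measure_countable1) auto
  then show ?thesis
    by (simp add: case_prod_beta' cong: measurable_cong_sets)
qed

lemma borel_prob_occupation: "borel_prob (occupation n x)"
  unfolding borel_prob_def occupation_def
  by (auto intro!: prob_space.prob_space_distr prob_space_pair prob_space_measure_pmf
      prob_space_S occupation_measurable)

lemma integral_occupation:
  fixes f :: "'x \<Rightarrow> real"
  assumes n: "0 < n" and [measurable]: "f \<in> borel_measurable borel" and bound: "\<And>x. \<bar>f x\<bar> \<le> B"
  shows "(\<integral>y. f y \<partial>occupation n x) = (1 / n) * (\<Sum>j = 1..n. \<integral>\<omega>. f (act (walk j \<omega>) x) \<partial>S)"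
proof -
  note [measurable] = occupation_measurable
  have "(\<integral>y. f y \<partial>occupation n x)
      = (\<integral>z. (\<lambda>(j, \<omega>). f (act (walk j \<omega>) x)) z \<partial>(measure_pmf (pmf_of_set {1..n}) \<Otimes>\<^sub>M S))"
    unfolding occupation_def by (subst integral_distr) (auto simp: case_prod_beta')
  also have "\<dots> = (\<integral>j. \<integral>\<omega>. f (act (walk j \<omega>) x) \<partial>S \<partial>measure_pmf (pmf_of_set {1..n}))"
    using measurable_compose[OF occupation_measurable, of f borel x "pmf_of_set {1..n}"]
    by (intro Fubini_bounded(1)[symmetric, where B = B])
      (auto intro: prob_space_S bound simp: case_prod_beta' prob_space_measure_pmf)
  also have "\<dots> = (1 / n) * (\<Sum>j = 1..n. \<integral>\<omega>. f (act (walk j \<omega>) x) \<partial>S)"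
    using n by (subst integral_pmf_of_set) auto
  finally show ?thesis .
qed

text \<open>Krylov--Bogolyubov: pushing the average forward by \<open>m\<close> changes only its two end terms.\<close>

lemma occupation_limit_stationary:
  assumes r: "strict_mono r" and N: "borel_prob N"
    and lim: "weak_star_lim (\<lambda>n. occupation (Suc (r n)) x) N"
  shows "stationary m act N"
proof -
  have [measurable_cong]: "sets N = sets borel" and N': "prob_space N"
    using N by (auto simp: borel_prob_def)
  have "conv act m N = N"
  proof (rule measure_eqI_continuous[OF _ N])
    show "borel_prob (conv act m N)"
      unfolding borel_prob_def conv_def
      by (auto intro!: prob_space.prob_space_distr prob_space_pair prob_space_m N')
    fix f :: "'x \<Rightarrow> real" assume f: "continuous_on UNIV f" and "\<And>x. 0 \<le> f x \<and> f x \<le> 1"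
    then have bound: "\<bar>f x\<bar> \<le> 1" for x by (simp add: abs_le_iff)
    have [measurable]: "f \<in> borel_measurable borel" by (rule borel_measurable_continuous_onI[OF f])
    \<comment> \<open>The Markov operator dual to convolution by \<open>m\<close>. It preserves
      continuity, so weak-* limits may be tested against \<open>Tf\<close> as well as against
      \<open>f\<close>.\<close>
    define Tf where "Tf y = (\<integral>h. f (act h y) \<partial>m)" for y
    have Tf: "continuous_on UNIV Tf"
      unfolding Tf_def
    proof (rule continuous_on_integral_bounded[where B = 1])
      show "finite_measure m" by (rule m.finite_measure_axioms)
      show "continuous_on UNIV (\<lambda>x. f (act s x))" for s
        by (rule continuous_on_compose2[OF f continuous_on_act]) auto
    qed (auto intro: bound)
    have Tf_bound: "\<bar>Tf y\<bar> \<le> 1" for y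
      unfolding Tf_def by (rule abs_integral_bounded) (auto intro: bound prob_space_m)
    have [measurable]: "Tf \<in> borel_measurable borel" by (rule borel_measurable_continuous_onI[OF Tf])
    define e where "e j = (\<integral>\<omega>. f (act (walk j \<omega>) x) \<partial>S)" for j
    have e_bound: "\<bar>e j\<bar> \<le> 1" for j
      unfolding e_def by (rule abs_integral_bounded) (auto intro: bound prob_space_S)
    have e2: "\<bar>e i - e j\<bar> \<le> 2" for i j
      using e_bound[of i] e_bound[of j] by linarith
    \<comment> \<open>Averaging over an extra letter in front advances the time by one.\<close>
    have step: "(\<integral>\<omega>. Tf (act (walk j \<omega>) x) \<partial>S) = e (Suc j)" for j
    proof -
      have "(\<integral>\<omega>. Tf (act (walk j \<omega>) x) \<partial>S) = (\<integral>h. \<integral>\<omega>. f (act h (act (walk j \<omega>) x)) \<partial>S \<partial>m)"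
        unfolding Tf_def by (rule Fubini_bounded(2)[where B = 1]) (auto intro: prob_space_S prob_space_m bound)
      also have "\<dots> = e (Suc j)"
        unfolding e_def by (subst expectation_walk_Suc[where B = 1]) (auto simp: act_plus bound)
      finally show ?thesis .
    qed
    have diff: "(\<integral>y. Tf y \<partial>occupation (Suc n) x) - (\<integral>y. f y \<partial>occupation (Suc n) x) = (e (Suc (Suc n)) - e 1) / Suc n" for n
    proof -
      have "(\<Sum>j = 1..Suc n. e (Suc j)) - (\<Sum>j = 1..Suc n. e j) = e (Suc (Suc n)) - e 1"
        using sum_Suc_diff[of 1 "Suc n" e] by (simp only: sum_subtractf[symmetric])
      then show ?thesis
        using integral_occupation[of "Suc n" Tf 1 x] integral_occupation[of "Suc n" f 1 x] Tf_bound bound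
        by (simp add: step e_def[symmetric] diff_divide_distrib[symmetric] del: sum.cl_ivl_Suc of_nat_Suc)
    qed
    have "(\<lambda>n. (e (Suc (Suc n)) - e 1) / Suc n) \<longlonglongrightarrow> 0"
    proof (rule Lim_null_comparison)
      show "eventually (\<lambda>n. norm ((e (Suc (Suc n)) - e 1) / Suc n) \<le> 2 * inverse (real (Suc n))) sequentially"
        by (intro always_eventually allI) (simp add: divide_simps e2)
      show "(\<lambda>n. 2 * inverse (real (Suc n))) \<longlonglongrightarrow> 0"
        using tendsto_mult_right_zero[OF LIMSEQ_inverse_real_of_nat] by simp
    qed
    then have "(\<lambda>n. (e (Suc (Suc (r n))) - e 1) / Suc (r n)) \<longlonglongrightarrow> 0"
      using LIMSEQ_subseq_LIMSEQ[OF _ r] by (simp add: comp_def)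
    then have "(\<lambda>n. (\<integral>y. Tf y \<partial>occupation (Suc (r n)) x) - (\<integral>y. f y \<partial>occupation (Suc (r n)) x)) \<longlonglongrightarrow> 0"
      unfolding diff .
    moreover have "(\<lambda>n. (\<integral>y. Tf y \<partial>occupation (Suc (r n)) x) - (\<integral>y. f y \<partial>occupation (Suc (r n)) x))
        \<longlonglongrightarrow> (\<integral>y. Tf y \<partial>N) - (\<integral>y. f y \<partial>N)"
      using lim f Tf by (intro tendsto_diff) (auto simp: weak_star_lim_def)
    ultimately have "(\<integral>y. Tf y \<partial>N) = (\<integral>y. f y \<partial>N)"
      using LIMSEQ_unique by fastforce
    moreover have "(\<integral>y. Tf y \<partial>N) = (\<integral>h. \<integral>y. f (act h y) \<partial>N \<partial>m)"
      unfolding Tf_def by (rule Fubini_bounded(2)[where B = 1]) (auto intro: N' prob_space_m bound)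
    ultimately show "(\<integral>y. f y \<partial>conv act m N) = (\<integral>y. f y \<partial>N)"
      by (subst integral_conv[OF N, where B = 1]) (auto intro: bound)
  qed
  with N show ?thesis by (simp add: stationary_def)
qed

text \<open>The freedom in \<open>r\<close> serves two ends: \<open>id\<close> gives the existence
  of a stationary measure, and a subsequence of bad times gives a contradiction when convergence of
  averages is at stake.\<close>

lemma stationary_subsequence:
  fixes r :: "nat \<Rightarrow> nat"
  assumes "strict_mono r"
  obtains s N where "strict_mono s" "stationary m act N"
    "weak_star_lim (\<lambda>n. occupation (Suc (r (s n))) x) N"
proof -
  obtain s N where s: "strict_mono s" and N: "borel_prob N"
    and lim: "weak_star_lim ((\<lambda>n. occupation (Suc (r n)) x) \<circ> s) N"
    using weak_star_subsequence[of "\<lambda>n. occupation (Suc (r n)) x"] borel_prob_occupation by metis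
  have "stationary m act N"
    by (rule occupation_limit_stationary[of "r \<circ> s" N x])
       (use lim N s assms in \<open>auto simp: comp_def strict_mono_o[unfolded comp_def]\<close>)
  with s lim show thesis by (intro that) (auto simp: comp_def)
qed

text \<open>If the averages stayed away from the limit along some subsequence, occupation measures
  along a further subsequence would converge to a stationary measure, which by uniqueness can only
  be \<open>\<nu>\<close>.\<close>

lemma unique_stationary_averages:
  fixes f :: "'x \<Rightarrow> real"
  assumes uniq: "\<And>\<nu>'. stationary m act \<nu>' \<Longrightarrow> \<nu>' = \<nu>" and f: "continuous_on UNIV f"
  shows "(\<lambda>n. (1 / real n) * (\<Sum>j = 1..n. \<integral>\<omega>. f (act (walk j \<omega>) x) \<partial>S)) \<longlonglongrightarrow> (\<integral>y. f y \<partial>\<nu>)"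
    (is "?a \<longlonglongrightarrow> ?l")
proof -
  define b where "b n = (\<integral>y. f y \<partial>occupation (Suc n) x)" for n
  obtain B where B: "\<And>x. \<bar>f x\<bar> \<le> B" using continuous_real_bounded[OF f] by blast
  have "b \<longlonglongrightarrow> ?l"
  proof (rule ccontr)
    assume "\<not> b \<longlonglongrightarrow> ?l"
    then obtain \<epsilon> where \<epsilon>: "\<epsilon> > 0" "\<forall>N. \<exists>n\<ge>N. \<not> dist (b n) ?l < \<epsilon>"
      by (auto simp: lim_sequentially)
    then have "infinite {n. \<not> dist (b n) ?l < \<epsilon>}"
      by (auto simp: infinite_nat_iff_unbounded_le)
    then obtain r :: "nat \<Rightarrow> nat" where r: "strict_mono r" "\<And>n. \<not> dist (b (r n)) ?l < \<epsilon>"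
      using infinite_enumerate by blast
    obtain s N where "strict_mono s" "stationary m act N"
      "weak_star_lim (\<lambda>n. occupation (Suc (r (s n))) x) N"
      using stationary_subsequence[OF r(1)] by blast
    with uniq f have "(\<lambda>n. b (r (s n))) \<longlonglongrightarrow> ?l"
      unfolding weak_star_lim_def b_def by blast
    then show False using \<epsilon>(1) r(2) by (auto simp: lim_sequentially)
  qed
  moreover have "b = (\<lambda>n. ?a (Suc n))"
    unfolding b_def using B borel_measurable_continuous_onI[OF f]
    by (intro ext, subst integral_occupation[where B = B]) auto
  ultimately have "(\<lambda>n. ?a (Suc n)) \<longlonglongrightarrow> ?l" by (simp only:)
  then show ?thesis by (rule filterlim_sequentially_Suc[THEN iffD1])
qed

section \<open>F-proximality through mean distances\<close>

definition mean_dist :: "nat \<Rightarrow> 'x \<Rightarrow> 'x \<Rightarrow> real" where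
  "mean_dist j x y = (\<integral>\<omega>. dist (act (walk j \<omega>) x) (act (walk j \<omega>) y) \<partial>S)"

lemma cesaro_eq: "A \<in> sets borel \<Longrightarrow> cesaro m n A = (1 / real n) * (\<Sum>j = 1..n. measure S {\<omega>. walk j \<omega> \<in> A})"
  by (simp add: cesaro_def measure_conv_power)

lemma space_S[simp]: "space S = UNIV"
  by (simp add: space_PiM)

lemma integrable_S: "f \<in> borel_measurable S \<Longrightarrow> (\<And>\<omega>. \<bar>f \<omega>\<bar> \<le> B) \<Longrightarrow> integrable S f" for f :: "_ \<Rightarrow> real"
  by (rule integrable_bounded[OF prob_space_S])

lemma mean_dist_nonneg: "0 \<le> mean_dist j x y"
  unfolding mean_dist_def by simp

text \<open>For distances bounded by \<open>D\<close>, smallness in probability and in mean are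
  equivalent: if \<open>A\<close> is the event of a distance above \<open>\<epsilon>\<close>, then
  \<open>\<epsilon> * 1_A \<le> dist \<le> \<epsilon> + D * 1_A\<close>, and Cesaro means respect
  both estimates.\<close>

lemma F_proximal_iff:
  "F_proximal m act \<longleftrightarrow> (\<forall>x y. (\<lambda>n. (1 / real n) * (\<Sum>j = 1..n. mean_dist j x y)) \<longlonglongrightarrow> 0)"
proof -
  obtain D where D: "0 < D" "\<And>x y :: 'x. dist x y \<le> D" using bounded_distances by blast
  define A where "A \<epsilon> x y = {g. dist (act g x) (act g y) > \<epsilon>}" for \<epsilon> x y
  have A[measurable]: "A \<epsilon> x y \<in> sets borel" for \<epsilon> x y
    unfolding A_def by measurable
  define p where "p \<epsilon> x y j = measure S {\<omega>. walk j \<omega> \<in> A \<epsilon> x y}" for \<epsilon> x y j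
  have p: "p \<epsilon> x y j = (\<integral>\<omega>. indicator (A \<epsilon> x y) (walk j \<omega>) \<partial>S)" for \<epsilon> x y j
  proof -
    have "(\<integral>\<omega>. indicator (A \<epsilon> x y) (walk j \<omega>) \<partial>S) = (\<integral>\<omega>. indicator {\<omega>. walk j \<omega> \<in> A \<epsilon> x y} \<omega> \<partial>S)"
      by (rule Bochner_Integration.integral_cong) (auto simp: indicator_def)
    also have "\<dots> = p \<epsilon> x y j"
    proof -
      have "{\<omega> \<in> space S. walk j \<omega> \<in> A \<epsilon> x y} \<in> sets S" by measurable
      then show ?thesis by (simp add: p_def)
    qed
    finally show ?thesis by simp
  qed
  have int_ind: "integrable S (\<lambda>\<omega>. indicator (A \<epsilon> x y) (walk j \<omega>) :: real)" for \<epsilon> x y j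
    by (rule integrable_S[where B = 1]) (auto simp: indicator_def)
  have int_dist: "integrable S (\<lambda>\<omega>. dist (act (walk j \<omega>) x) (act (walk j \<omega>) y))" for x y j
    by (rule integrable_S[where B = D]) (auto simp: D)
  have upper: "mean_dist j x y \<le> \<epsilon> + D * p \<epsilon> x y j" if "0 < \<epsilon>" for \<epsilon> x y j
  proof -
    have "mean_dist j x y \<le> (\<integral>\<omega>. \<epsilon> + D * indicator (A \<epsilon> x y) (walk j \<omega>) \<partial>S)"
      unfolding mean_dist_def using D that
      by (intro integral_mono int_dist Bochner_Integration.integrable_add integrable_mult_right int_ind)
        (auto simp: A_def indicator_def intro: order_trans[OF D(2)])
    also have "\<dots> = \<epsilon> + D * p \<epsilon> x y j"
      using int_ind P.prob_space by (simp add: p)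
    finally show ?thesis .
  qed
  have lower: "\<epsilon> * p \<epsilon> x y j \<le> mean_dist j x y" if "0 < \<epsilon>" for \<epsilon> x y j
  proof -
    have "\<epsilon> * p \<epsilon> x y j = (\<integral>\<omega>. \<epsilon> * indicator (A \<epsilon> x y) (walk j \<omega>) \<partial>S)" by (simp add: p)
    also have "\<dots> \<le> mean_dist j x y"
      unfolding mean_dist_def using that
      by (intro integral_mono int_dist integrable_mult_right int_ind) (auto simp: A_def indicator_def)
    finally show ?thesis .
  qed
  have ces: "cesaro m n {g. dist (act g x) (act g y) > \<epsilon>} = (1 / real n) * (\<Sum>j = 1..n. p \<epsilon> x y j)" for n x y \<epsilon>
    using cesaro_eq[OF A] by (simp add: p_def A_def)
  have p_nonneg: "0 \<le> p \<epsilon> x y j" for \<epsilon> x y j by (simp add: p_def)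
  show ?thesis
    unfolding F_proximal_def ces
  proof (intro iffI allI impI)
    fix x y \<epsilon> assume "\<forall>x y. (\<lambda>n. (1 / real n) * (\<Sum>j = 1..n. mean_dist j x y)) \<longlonglongrightarrow> 0" and \<epsilon>: "0 < (\<epsilon> :: real)"
    then have "(\<lambda>n. (1 / \<epsilon>) * ((1 / real n) * (\<Sum>j = 1..n. mean_dist j x y))) \<longlonglongrightarrow> 0"
      using tendsto_mult_right_zero by blast
    then show "(\<lambda>n. (1 / real n) * (\<Sum>j = 1..n. p \<epsilon> x y j)) \<longlonglongrightarrow> 0"
    proof (rule Lim_null_comparison[rotated], intro always_eventually allI)
      fix n
      have "\<epsilon> * (\<Sum>j = 1..n. p \<epsilon> x y j) \<le> (\<Sum>j = 1..n. mean_dist j x y)"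
        unfolding sum_distrib_left using lower[OF \<epsilon>] by (rule sum_mono)
      then have "(\<Sum>j = 1..n. p \<epsilon> x y j) \<le> (1 / \<epsilon>) * (\<Sum>j = 1..n. mean_dist j x y)"
        using \<epsilon> by (simp add: field_simps)
      from mult_left_mono[OF this, of "1 / real n"]
      show "norm ((1 / real n) * (\<Sum>j = 1..n. p \<epsilon> x y j)) \<le> (1 / \<epsilon>) * ((1 / real n) * (\<Sum>j = 1..n. mean_dist j x y))"
        using p_nonneg by (simp add: sum_nonneg abs_mult mult_ac)
    qed
  next
    fix x y assume *: "\<forall>x y. \<forall>\<epsilon>>0. (\<lambda>n. (1 / real n) * (\<Sum>j = 1..n. p \<epsilon> x y j)) \<longlonglongrightarrow> 0"
    show "(\<lambda>n. (1 / real n) * (\<Sum>j = 1..n. mean_dist j x y)) \<longlonglongrightarrow> 0"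
    proof (rule tendstoI)
      fix e :: real assume e: "0 < e"
      \<comment> \<open>Half of \<open>e\<close> is the threshold of the event, the other half
        bounds \<open>D\<close> times its averaged probability.\<close>
      have "(\<lambda>n. D * ((1 / real n) * (\<Sum>j = 1..n. p (e/2) x y j))) \<longlonglongrightarrow> 0"
        using * e by (intro tendsto_mult_right_zero) simp
      then have "eventually (\<lambda>n. D * ((1 / real n) * (\<Sum>j = 1..n. p (e/2) x y j)) < e / 2) sequentially"
        using e by (intro order_tendstoD) auto
      then show "eventually (\<lambda>n. dist ((1 / real n) * (\<Sum>j = 1..n. mean_dist j x y)) 0 < e) sequentially"
        using eventually_gt_at_top[of 0]
      proof eventually_elim
        case (elim n)
        have "(\<Sum>j = 1..n. mean_dist j x y) \<le> (\<Sum>j = 1..n. e / 2 + D * p (e/2) x y j)"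
          using e by (intro sum_mono upper) simp
        also have "\<dots> = n * (e / 2) + D * (\<Sum>j = 1..n. p (e/2) x y j)"
          by (simp add: sum.distrib sum_distrib_left)
        finally have "(1 / real n) * (\<Sum>j = 1..n. mean_dist j x y) \<le> e / 2 + D * ((1 / real n) * (\<Sum>j = 1..n. p (e/2) x y j))"
          using elim by (simp add: field_simps)
        moreover have "0 \<le> (1 / real n) * (\<Sum>j = 1..n. mean_dist j x y)"
          by (intro mult_nonneg_nonneg sum_nonneg mean_dist_nonneg) simp
        ultimately show ?case
          using elim(1) unfolding dist_real_def diff_zero by linarith
      qed
    qed
  qed
qed

section \<open>Radius and spread of translated measures\<close>

text \<open>The transport distance from the translate of \<open>\<nu>\<close> by \<open>g\<close> to
  the point mass at \<open>z\<close>.\<close>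

definition radius :: "'x measure \<Rightarrow> 'x \<Rightarrow> 'g \<Rightarrow> real" where
  "radius \<nu> z g = (\<integral>x. dist (act g x) z \<partial>\<nu>)"

text \<open>The mean distance between independent points of the two translates. For
  \<open>\<nu> = \<nu>'\<close> it measures closeness to a point mass without naming the point, so
  it can be averaged over \<open>g\<close>.\<close>

definition spread :: "'x measure \<Rightarrow> 'x measure \<Rightarrow> 'g \<Rightarrow> real" where
  "spread \<nu> \<nu>' g = (\<integral>x. \<integral>y. dist (act g x) (act g y) \<partial>\<nu>' \<partial>\<nu>)"

lemma radius_measurable[measurable (raw)]:
  assumes \<nu>: "borel_prob \<nu>" and [measurable]: "f \<in> borel_measurable M" "g \<in> borel_measurable M"
  shows "(\<lambda>t. radius \<nu> (f t) (g t)) \<in> borel_measurable M"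
proof -
  interpret \<nu>: prob_space \<nu> by (rule borel_probD[OF \<nu>])
  note [measurable_cong] = borel_probD(2)[OF \<nu>]
  show ?thesis unfolding radius_def by measurable
qed

lemma spread_measurable[measurable (raw)]:
  assumes \<nu>: "borel_prob \<nu>" "borel_prob \<nu>'" and [measurable]: "g \<in> borel_measurable M"
  shows "(\<lambda>t. spread \<nu> \<nu>' (g t)) \<in> borel_measurable M"
proof -
  interpret \<nu>: prob_space \<nu> by (rule borel_probD[OF \<nu>(1)])
  interpret \<nu>': prob_space \<nu>' by (rule borel_probD[OF \<nu>(2)])
  note [measurable_cong] = \<nu>[THEN borel_probD(2)]
  show ?thesis unfolding spread_def by measurable
qed

lemma mean_dist_measurable[measurable (raw)]:
  assumes [measurable]: "f \<in> borel_measurable M" "g \<in> borel_measurable M"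
  shows "(\<lambda>t. mean_dist j (f t) (g t)) \<in> borel_measurable M"
  unfolding mean_dist_def by measurable

lemma expected_spread:
  assumes \<nu>: "borel_prob \<nu>" "borel_prob \<nu>'"
  shows "(\<integral>\<omega>. spread \<nu> \<nu>' (walk j \<omega>) \<partial>S) = (\<integral>z. mean_dist j (fst z) (snd z) \<partial>(\<nu> \<Otimes>\<^sub>M \<nu>'))"
proof -
  obtain D where D: "0 < D" "\<And>x y :: 'x. dist x y \<le> D" using bounded_distances by blast
  interpret \<nu>: prob_space \<nu> by (rule borel_probD[OF \<nu>(1)])
  interpret \<nu>': prob_space \<nu>' by (rule borel_probD[OF \<nu>(2)])
  note [measurable_cong] = \<nu>[THEN borel_probD(2)]
  note prob = \<nu>[THEN borel_probD(1)]
  have "spread \<nu> \<nu>' (walk j \<omega>) = (\<integral>z. (\<lambda>(x, y). dist (act (walk j \<omega>) x) (act (walk j \<omega>) y)) z \<partial>(\<nu> \<Otimes>\<^sub>M \<nu>'))" for \<omega>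
    unfolding spread_def by (rule Fubini_bounded(1)[where B = D]) (auto simp: D prob)
  then have "(\<integral>\<omega>. spread \<nu> \<nu>' (walk j \<omega>) \<partial>S)
      = (\<integral>\<omega>. \<integral>z. dist (act (walk j \<omega>) (fst z)) (act (walk j \<omega>) (snd z)) \<partial>(\<nu> \<Otimes>\<^sub>M \<nu>') \<partial>S)"
    by (simp add: case_prod_beta')
  also have "\<dots> = (\<integral>z. mean_dist j (fst z) (snd z) \<partial>(\<nu> \<Otimes>\<^sub>M \<nu>'))"
    unfolding mean_dist_def
    by (rule Fubini_bounded(2)[symmetric, where B = D]) (auto simp: D prob_space_S intro!: prob_space_pair prob)
  finally show ?thesis .
qed

text \<open>Dominated convergence integrates the Cesaro means of \<open>mean_dist\<close> over the
  product measure, and \<open>expected_spread\<close> identifies the result. A mean below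
  \<open>\<eta>\<close> has a term below \<open>\<eta>\<close>, and the applications ask for one
  good time only.\<close>

lemma F_proximal_small_spread:
  assumes F: "F_proximal m act" and \<nu>: "borel_prob \<nu>" "borel_prob \<nu>'" and "0 < \<eta>"
  obtains j where "(\<integral>\<omega>. spread \<nu> \<nu>' (walk j \<omega>) \<partial>S) < \<eta>"
proof -
  obtain D where D: "0 < D" "\<And>x y :: 'x. dist x y \<le> D" using bounded_distances by blast
  note [measurable_cong] = \<nu>[THEN borel_probD(2)]
  interpret pair: prob_space "\<nu> \<Otimes>\<^sub>M \<nu>'" by (intro prob_space_pair borel_probD \<nu>)
  define s where "s j = (\<integral>\<omega>. spread \<nu> \<nu>' (walk j \<omega>) \<partial>S)" for j
  have md: "\<bar>mean_dist j x y\<bar> \<le> D" for j x y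
    unfolding mean_dist_def by (rule abs_integral_bounded) (auto simp: D prob_space_S)
  have avg: "\<bar>(1 / real n) * (\<Sum>j = 1..n. mean_dist j x y)\<bar> \<le> D" for n x y
  proof (cases "n = 0")
    case False
    have "\<bar>\<Sum>j = 1..n. mean_dist j x y\<bar> \<le> (\<Sum>j = 1..n. D)"
      by (rule order_trans[OF sum_abs sum_mono[OF md]])
    with False show ?thesis by (simp add: abs_mult field_simps)
  qed (use D in simp)
  have "(\<lambda>n. \<integral>z. (1 / real n) * (\<Sum>j = 1..n. mean_dist j (fst z) (snd z)) \<partial>(\<nu> \<Otimes>\<^sub>M \<nu>')) \<longlonglongrightarrow> (\<integral>z. 0 \<partial>(\<nu> \<Otimes>\<^sub>M \<nu>'))"
    by (rule integral_dominated_convergence[where w = "\<lambda>_. D"])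
       (use F avg in \<open>auto simp: F_proximal_iff\<close>)
  moreover have "(\<integral>z. (1 / real n) * (\<Sum>j = 1..n. mean_dist j (fst z) (snd z)) \<partial>(\<nu> \<Otimes>\<^sub>M \<nu>')) = (1 / real n) * (\<Sum>j = 1..n. s j)" for n
  proof -
    have "integrable (\<nu> \<Otimes>\<^sub>M \<nu>') (\<lambda>z. mean_dist j (fst z) (snd z))" for j
      by (rule integrable_bounded[where B = D]) (auto simp: md pair.prob_space_axioms)
    then show ?thesis
      by (simp add: s_def expected_spread[OF \<nu>])
  qed
  ultimately have "(\<lambda>n. (1 / real n) * (\<Sum>j = 1..n. s j)) \<longlonglongrightarrow> (\<integral>z. 0 \<partial>(\<nu> \<Otimes>\<^sub>M \<nu>'))"
    by (simp only:)
  then have "(\<lambda>n. (1 / real n) * (\<Sum>j = 1..n. s j)) \<longlonglongrightarrow> 0" by simp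
  then have "eventually (\<lambda>n. (1 / real n) * (\<Sum>j = 1..n. s j) < \<eta>) sequentially"
    using \<open>0 < \<eta>\<close> by (rule order_tendstoD)
  then obtain n where n: "0 < n" "(1 / real n) * (\<Sum>j = 1..n. s j) < \<eta>"
    using eventually_gt_at_top[of "0::nat"] eventually_conj eventually_happens'[OF sequentially_bot] by blast
  have "\<exists>j. s j < \<eta>"
  proof (rule ccontr)
    assume "\<not> ?thesis"
    then have "(\<Sum>j = 1..n. \<eta>) \<le> (\<Sum>j = 1..n. s j)" by (intro sum_mono) (simp add: not_less)
    with n show False by (simp add: field_simps)
  qed
  then show thesis using that by (auto simp: s_def)
qed

section \<open>Uniqueness of the stationary measure\<close>

text \<open>By stationarity both integrals of \<open>f\<close> may be computed after any number
  \<open>j\<close> of steps. At a time of small expected spread the two translates are close on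
  average, and so are the integrals.\<close>

lemma F_proximal_stationary_unique:
  assumes F: "F_proximal m act" and \<nu>: "stationary m act \<nu>" and \<nu>': "stationary m act \<nu>'"
  shows "\<nu> = \<nu>'"
proof (rule measure_eqI_continuous)
  obtain D where D: "0 < D" "\<And>x y :: 'x. dist x y \<le> D" using bounded_distances by blast
  show bp: "borel_prob \<nu>" "borel_prob \<nu>'" using \<nu> \<nu>' by (auto simp: stationary_def)
  interpret \<nu>: prob_space \<nu> by (rule borel_probD[OF bp(1)])
  interpret \<nu>': prob_space \<nu>' by (rule borel_probD[OF bp(2)])
  note [measurable_cong] = bp[THEN borel_probD(2)]
  note prob = bp[THEN borel_probD(1)]
  fix f :: "'x \<Rightarrow> real" assume f: "continuous_on UNIV f" and "\<And>x. 0 \<le> f x \<and> f x \<le> 1"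
  then have bound: "\<bar>f x\<bar> \<le> 1" for x by (simp add: abs_le_iff)
  have [measurable]: "f \<in> borel_measurable borel" by (rule borel_measurable_continuous_onI[OF f])
  have small: "\<bar>(\<integral>x. f x \<partial>\<nu>) - (\<integral>y. f y \<partial>\<nu>')\<bar> \<le> 2 * \<epsilon>" if \<epsilon>: "0 < \<epsilon>" for \<epsilon>
  proof -
    obtain C where C: "0 < C" "\<And>u v. \<bar>f u - f v\<bar> \<le> \<epsilon> + C * dist u v"
      using continuous_dist_modulus[OF f \<epsilon>] by blast
    \<comment> \<open>The time depends on \<open>C\<close>, hence on \<open>f\<close> and
      \<open>\<epsilon>\<close>; it makes the spread term cost at most
      \<open>\<epsilon>\<close>.\<close>
    obtain j where j: "(\<integral>\<omega>. spread \<nu> \<nu>' (walk j \<omega>) \<partial>S) < \<epsilon> / C"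
      using F_proximal_small_spread[OF F bp, of "\<epsilon> / C"] \<epsilon> C by auto
    define a where "a g = (\<integral>x. f (act g x) \<partial>\<nu>)" for g
    define b where "b g = (\<integral>y. f (act g y) \<partial>\<nu>')" for g
    have ab: "\<bar>a g\<bar> \<le> 1" "\<bar>b g\<bar> \<le> 1" for g
      unfolding a_def b_def by (auto intro!: abs_integral_bounded bound prob)
    have [measurable]: "a \<in> borel_measurable borel" "b \<in> borel_measurable borel"
      unfolding a_def[abs_def] b_def[abs_def] by measurable
    have spread_b: "\<bar>spread \<nu> \<nu>' g\<bar> \<le> D" for g
      unfolding spread_def by (intro abs_integral_bounded prob) (simp add: D)
    have pointwise: "\<bar>a g - b g\<bar> \<le> \<epsilon> + C * spread \<nu> \<nu>' g" for g
    proof -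
      have int_f: "integrable \<nu> (\<lambda>x. f (act g x))" "integrable \<nu>' (\<lambda>x. f (act g x))"
        by (rule integrable_bounded[where B = 1]; simp add: bound prob)+
      have int_d: "integrable \<nu>' (\<lambda>y. dist (act g x) (act g y))" for x
        by (rule integrable_bounded[where B = D]) (auto simp: D prob)
      have int_dd: "integrable \<nu> (\<lambda>x. \<integral>y. dist (act g x) (act g y) \<partial>\<nu>')"
      proof (rule integrable_bounded[where B = D])
        show "\<bar>\<integral>y. dist (act g x) (act g y) \<partial>\<nu>'\<bar> \<le> D" for x
          by (intro abs_integral_bounded prob) (simp add: D)
      qed (auto simp: prob)
      have "\<bar>a g - b g\<bar> = \<bar>\<integral>x. f (act g x) - b g \<partial>\<nu>\<bar>"
        using int_f by (simp add: a_def \<nu>.prob_space)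
      also have "\<dots> \<le> (\<integral>x. \<bar>f (act g x) - b g\<bar> \<partial>\<nu>)"
        by (rule integral_abs_bound)
      also have "\<dots> \<le> (\<integral>x. \<epsilon> + C * (\<integral>y. dist (act g x) (act g y) \<partial>\<nu>') \<partial>\<nu>)"
      proof (rule integral_mono)
        fix x
        have "\<bar>f (act g x) - b g\<bar> = \<bar>\<integral>y. f (act g x) - f (act g y) \<partial>\<nu>'\<bar>"
          using int_f by (simp add: b_def \<nu>'.prob_space)
        also have "\<dots> \<le> (\<integral>y. \<bar>f (act g x) - f (act g y)\<bar> \<partial>\<nu>')"
          by (rule integral_abs_bound)
        also have "\<dots> \<le> (\<integral>y. \<epsilon> + C * dist (act g x) (act g y) \<partial>\<nu>')"
          using int_f int_d C by (intro integral_mono) auto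
        also have "\<dots> = \<epsilon> + C * (\<integral>y. dist (act g x) (act g y) \<partial>\<nu>')"
          using int_d by (simp add: \<nu>'.prob_space)
        finally show "\<bar>f (act g x) - b g\<bar> \<le> \<epsilon> + C * (\<integral>y. dist (act g x) (act g y) \<partial>\<nu>')" .
      qed (use int_f int_dd in auto)
      also have "\<dots> = \<epsilon> + C * spread \<nu> \<nu>' g"
        using int_dd by (simp add: \<nu>.prob_space spread_def)
      finally show ?thesis .
    qed
    have int: "integrable S (\<lambda>\<omega>. a (walk j \<omega>))" "integrable S (\<lambda>\<omega>. b (walk j \<omega>))"
      by (rule integrable_S[where B = 1]; simp add: ab)+
    have int_s: "integrable S (\<lambda>\<omega>. spread \<nu> \<nu>' (walk j \<omega>))"
      by (rule integrable_S[where B = D]) (auto simp: spread_b bp)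
    have "(\<integral>x. f x \<partial>\<nu>) - (\<integral>y. f y \<partial>\<nu>') = (\<integral>\<omega>. a (walk j \<omega>) - b (walk j \<omega>) \<partial>S)"
      using int integral_stationary_walk[where f = f and B = 1 and n = j, OF \<nu> _ bound] integral_stationary_walk[where f = f and B = 1 and n = j, OF \<nu>' _ bound]
      by (simp add: a_def b_def)
    also have "\<bar>\<dots>\<bar> \<le> (\<integral>\<omega>. \<bar>a (walk j \<omega>) - b (walk j \<omega>)\<bar> \<partial>S)"
      by (rule integral_abs_bound)
    also have "\<dots> \<le> (\<integral>\<omega>. \<epsilon> + C * spread \<nu> \<nu>' (walk j \<omega>) \<partial>S)"
      using int int_s by (intro integral_mono) (auto simp: pointwise)
    also have "\<dots> = \<epsilon> + C * (\<integral>\<omega>. spread \<nu> \<nu>' (walk j \<omega>) \<partial>S)"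
      using int_s by (simp add: P.prob_space[simplified])
    also have "\<dots> \<le> 2 * \<epsilon>"
      using j C by (simp add: field_simps)
    finally show ?thesis .
  qed
  have "\<bar>(\<integral>x. f x \<partial>\<nu>) - (\<integral>y. f y \<partial>\<nu>')\<bar> \<le> 0"
  proof (rule field_le_epsilon)
    fix e :: real assume "0 < e"
    then show "\<bar>(\<integral>x. f x \<partial>\<nu>) - (\<integral>y. f y \<partial>\<nu>')\<bar> \<le> 0 + e" using small[of "e / 2"] by simp
  qed
  then show "(\<integral>x. f x \<partial>\<nu>) = (\<integral>y. f y \<partial>\<nu>')" by simp
qed

section \<open>Translates close to point masses\<close>

lemma radius_nonneg: "0 \<le> radius \<nu> z g"
  unfolding radius_def by simp

lemma spread_nonneg: "0 \<le> spread \<nu> \<nu>' g"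
  unfolding spread_def by simp

lemma radius_le:
  assumes "borel_prob \<nu>" "\<And>x y :: 'x. dist x y \<le> D"
  shows "\<bar>radius \<nu> z g\<bar> \<le> D"
  unfolding radius_def using assms by (intro abs_integral_bounded borel_probD) auto

lemma integrable_dist_act:
  assumes "borel_prob \<nu>"
  shows "integrable \<nu> (\<lambda>x. dist (act g x) z)"
proof -
  obtain D where D: "0 < D" "\<And>x y :: 'x. dist x y \<le> D" using bounded_distances by blast
  note [measurable_cong] = borel_probD(2)[OF assms]
  show ?thesis by (rule integrable_bounded[OF borel_probD(1)[OF assms], where B = D]) (auto simp: D)
qed

lemma radius_triangle:
  assumes "borel_prob \<nu>"
  shows "radius \<nu> z g \<le> radius \<nu> z' g + dist z z'"
proof -
  interpret \<nu>: prob_space \<nu> by (rule borel_probD[OF assms])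
  have "radius \<nu> z g \<le> (\<integral>x. dist (act g x) z' + dist z z' \<partial>\<nu>)"
    unfolding radius_def
    by (intro integral_mono integrable_dist_act assms Bochner_Integration.integrable_add) (auto simp: dist_triangle2)
  also have "\<dots> = radius \<nu> z' g + dist z z'"
    using integrable_dist_act[OF assms] by (simp add: radius_def \<nu>.prob_space)
  finally show ?thesis .
qed

text \<open>Every point of the translate links \<open>z\<close> to \<open>z'\<close> by the triangle
  inequality. So two good centres for the same \<open>g\<close> are close to each other.\<close>

lemma dist_le_radius:
  assumes "borel_prob \<nu>"
  shows "dist z z' \<le> radius \<nu> z g + radius \<nu> z' g"
proof -
  interpret \<nu>: prob_space \<nu> by (rule borel_probD[OF assms])
  have "dist z z' = (\<integral>x. dist z z' \<partial>\<nu>)" by (simp add: \<nu>.prob_space)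
  also have "\<dots> \<le> (\<integral>x. dist (act g x) z + dist (act g x) z' \<partial>\<nu>)"
    by (intro integral_mono integrable_dist_act assms Bochner_Integration.integrable_add) (auto simp: dist_triangle3)
  also have "\<dots> = radius \<nu> z g + radius \<nu> z' g"
    using integrable_dist_act[OF assms] by (simp add: radius_def)
  finally show ?thesis .
qed

lemma spread_eq_integral_radius: "spread \<nu> \<nu>' g = (\<integral>x. radius \<nu>' (act g x) g \<partial>\<nu>)"
  unfolding spread_def radius_def by (simp add: dist_commute)

text \<open>The spread is the average of the radii about the points of the translate itself, so not
  all of these radii can exceed it by \<open>\<eta>\<close>.\<close>

lemma radius_near_spread:
  assumes \<nu>: "borel_prob \<nu>" and "0 < \<eta>"
  obtains x where "radius \<nu> (act g x) g < spread \<nu> \<nu> g + \<eta>"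
proof -
  interpret \<nu>: prob_space \<nu> by (rule borel_probD[OF \<nu>])
  note [measurable_cong] = borel_probD(2)[OF \<nu>]
  obtain D where D: "0 < D" "\<And>x y :: 'x. dist x y \<le> D" using bounded_distances by blast
  have "\<exists>x. radius \<nu> (act g x) g < spread \<nu> \<nu> g + \<eta>"
  proof (rule ccontr)
    assume "\<not> ?thesis"
    then have *: "spread \<nu> \<nu> g + \<eta> \<le> radius \<nu> (act g x) g" for x by (simp add: not_less)
    have "integrable \<nu> (\<lambda>x. radius \<nu> (act g x) g)"
      by (rule integrable_bounded[OF borel_probD(1)[OF \<nu>], where B = D])
         (use \<nu> in \<open>auto intro!: radius_le D\<close>)
    then have "(\<integral>x. spread \<nu> \<nu> g + \<eta> \<partial>\<nu>) \<le> (\<integral>x. radius \<nu> (act g x) g \<partial>\<nu>)"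
      by (intro integral_mono *) auto
    then show False
      using \<open>0 < \<eta>\<close> by (simp add: spread_eq_integral_radius[symmetric] \<nu>.prob_space)
  qed
  then show thesis using that by blast
qed

text \<open>Independent points of the translate are joined through \<open>z\<close>. With
  \<open>radius_near_spread\<close>, the spread and the best radius control each other.\<close>

lemma spread_le_radius:
  assumes \<nu>: "borel_prob \<nu>"
  shows "spread \<nu> \<nu> g \<le> 2 * radius \<nu> z g"
proof -
  interpret \<nu>: prob_space \<nu> by (rule borel_probD[OF \<nu>])
  note [measurable_cong] = borel_probD(2)[OF \<nu>]
  obtain D where D: "0 < D" "\<And>x y :: 'x. dist x y \<le> D" using bounded_distances by blast
  have "integrable \<nu> (\<lambda>x. radius \<nu> (act g x) g)"
    by (rule integrable_bounded[OF borel_probD(1)[OF \<nu>], where B = D])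
       (use \<nu> in \<open>auto intro!: radius_le D\<close>)
  then have "spread \<nu> \<nu> g \<le> (\<integral>x. radius \<nu> z g + dist (act g x) z \<partial>\<nu>)"
    unfolding spread_eq_integral_radius
    by (intro integral_mono Bochner_Integration.integrable_add integrable_dist_act \<nu> radius_triangle) auto
  also have "\<dots> = 2 * radius \<nu> z g"
    using integrable_dist_act[OF \<nu>, of g z] by (simp add: \<nu>.prob_space radius_def)
  finally show ?thesis .
qed

text \<open>The distance to \<open>z\<close> is itself a test function; conversely, the affine
  modulus of any test function bounds its deviation by the radius.\<close>

lemma weak_star_lim_iff_radius:
  assumes \<nu>: "borel_prob \<nu>"
  shows "weak_star_lim (\<lambda>n. distr \<nu> borel (act (walk n \<omega>))) (return borel z) \<longleftrightarrow>
    (\<lambda>n. radius \<nu> z (walk n \<omega>)) \<longlonglongrightarrow> 0"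
proof -
  interpret \<nu>: prob_space \<nu> by (rule borel_probD[OF \<nu>])
  note [measurable_cong] = borel_probD(2)[OF \<nu>]
  have int: "(\<integral>x. f x \<partial>distr \<nu> borel (act g)) = (\<integral>x. f (act g x) \<partial>\<nu>)" "(\<integral>x. f x \<partial>return borel z) = f z"
    if "continuous_on UNIV f" for f :: "'x \<Rightarrow> real" and g
    using borel_measurable_continuous_onI[OF that] by (simp_all add: integral_distr integral_return)
  show ?thesis
  proof
    assume lim: "weak_star_lim (\<lambda>n. distr \<nu> borel (act (walk n \<omega>))) (return borel z)"
    have "continuous_on UNIV (\<lambda>x. dist x z)" by (intro continuous_intros)
    from lim[unfolded weak_star_lim_def, rule_format, OF this]
    have "(\<lambda>n. \<integral>x. dist x z \<partial>distr \<nu> borel (act (walk n \<omega>))) \<longlonglongrightarrow> (\<integral>x. dist x z \<partial>return borel z)" .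
    then show "(\<lambda>n. radius \<nu> z (walk n \<omega>)) \<longlonglongrightarrow> 0"
      by (simp add: int radius_def continuous_intros)
  next
    assume lim: "(\<lambda>n. radius \<nu> z (walk n \<omega>)) \<longlonglongrightarrow> 0"
    show "weak_star_lim (\<lambda>n. distr \<nu> borel (act (walk n \<omega>))) (return borel z)"
      unfolding weak_star_lim_def
    proof (intro allI impI, rule tendstoI)
      fix f :: "'x \<Rightarrow> real" and e :: real assume f: "continuous_on UNIV f" and e: "0 < e"
      obtain C where C: "0 < C" "\<And>u v. \<bar>f u - f v\<bar> \<le> e / 2 + C * dist u v"
        using continuous_dist_modulus[OF f, of "e / 2"] e by auto
      obtain B where B: "0 < B" "\<And>x. \<bar>f x\<bar> \<le> B" using continuous_real_bounded[OF f] by blast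
      have [measurable]: "f \<in> borel_measurable borel" by (rule borel_measurable_continuous_onI[OF f])
      have est: "\<bar>(\<integral>x. f (act g x) \<partial>\<nu>) - f z\<bar> \<le> e / 2 + C * radius \<nu> z g" for g
      proof -
        have int_f: "integrable \<nu> (\<lambda>x. f (act g x))"
          by (rule integrable_bounded[OF borel_probD(1)[OF \<nu>], where B = B]) (auto simp: B)
        have "\<bar>(\<integral>x. f (act g x) \<partial>\<nu>) - f z\<bar> = \<bar>\<integral>x. f (act g x) - f z \<partial>\<nu>\<bar>"
          using int_f by (simp add: \<nu>.prob_space)
        also have "\<dots> \<le> (\<integral>x. \<bar>f (act g x) - f z\<bar> \<partial>\<nu>)" by (rule integral_abs_bound)
        also have "\<dots> \<le> (\<integral>x. e / 2 + C * dist (act g x) z \<partial>\<nu>)"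
          using int_f integrable_dist_act[OF \<nu>, of g z] C by (intro integral_mono) auto
        also have "\<dots> = e / 2 + C * radius \<nu> z g"
          using integrable_dist_act[OF \<nu>, of g z] by (simp add: \<nu>.prob_space radius_def)
        finally show ?thesis .
      qed
      have "(\<lambda>n. C * radius \<nu> z (walk n \<omega>)) \<longlonglongrightarrow> 0"
        using lim by (rule tendsto_mult_right_zero)
      then have "eventually (\<lambda>n. C * radius \<nu> z (walk n \<omega>) < e / 2) sequentially"
        using e by (intro order_tendstoD) auto
      then show "eventually (\<lambda>n. dist (\<integral>x. f x \<partial>distr \<nu> borel (act (walk n \<omega>))) (\<integral>x. f x \<partial>return borel z) < e) sequentially"
      proof eventually_elim
        case (elim n)
        then show ?case using est[of "walk n \<omega>"] by (simp add: int f dist_real_def)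
      qed
    qed
  qed
qed

lemma m_proximal_iff_radius:
  assumes "borel_prob \<nu>"
  shows "m_proximal m act \<nu> \<longleftrightarrow> (AE \<omega> in S. \<exists>z. (\<lambda>n. radius \<nu> z (walk n \<omega>)) \<longlonglongrightarrow> 0)"
  unfolding m_proximal_def walk_def[symmetric] weak_star_lim_iff_radius[OF assms] ..

section \<open>Martingale estimates for the radius\<close>

text \<open>
  The maximal inequality for nonnegative martingales, by conditioning on the first step: if
  \<open>u g \<le> c\<close>, a later exceedance starts afresh from \<open>g + h\<close>, where \<open>h\<close> has law \<open>m\<close>.
\<close>

lemma maximal_inequality_finite:
  fixes u :: "'g \<Rightarrow> real"
  assumes [measurable]: "u \<in> borel_measurable borel"
    and u: "\<And>g. 0 \<le> u g" "\<And>g. u g \<le> B" and harm: "\<And>g. u g = (\<integral>h. u (g + h) \<partial>m)" and c: "0 < c"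
  shows "measure S {\<omega>. \<exists>k\<le>n. c < u (g + walk k \<omega>)} \<le> u g / c"
proof (induction n arbitrary: g)
  case 0
  show ?case
  proof (cases "c < u g")
    case True
    with c have "1 \<le> u g / c" by (simp add: field_simps)
    with P.prob_le_1 show ?thesis by (rule order_trans)
  next
    case False
    with u c show ?thesis by simp
  qed
next
  case (Suc n)
  show ?case
  proof (cases "c < u g")
    case True
    with c have "1 \<le> u g / c" by (simp add: field_simps)
    with P.prob_le_1 show ?thesis by (rule order_trans)
  next
    case False
    define E where "E n g = {\<omega>. \<exists>k\<le>n. c < u (g + walk k \<omega>)}" for n g
    have [measurable]: "E n g \<in> sets S" for n g
    proof -
      have "{\<omega> \<in> space S. \<exists>k\<le>n. c < u (g + walk k \<omega>)} \<in> sets S" by measurable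
      then show ?thesis by (simp add: E_def)
    qed
    \<comment> \<open>Time 0 gives no exceedance because \<open>c < u g\<close> fails, so any
      witness can be shifted by one letter.\<close>
    have E_Suc: "case_nat h \<omega> \<in> E (Suc n) g \<longleftrightarrow> \<omega> \<in> E n (g + h)" for h \<omega>
    proof -
      have "(\<exists>k\<le>Suc n. c < u (g + walk k (case_nat h \<omega>))) \<longleftrightarrow>
          c < u g \<or> (\<exists>k\<le>n. c < u (g + walk (Suc k) (case_nat h \<omega>)))"
        by (metis Suc_le_mono add_0_right le0 not0_implies_Suc walk_0)
      with False show ?thesis by (simp add: E_def walk_case_nat add.assoc)
    qed
    have "measure S (E (Suc n) g) = (\<integral>\<omega>. indicator (E (Suc n) g) \<omega> \<partial>S)" by simp
    also have "\<dots> = (\<integral>h. \<integral>\<omega>. indicator (E (Suc n) g) (case_nat h \<omega>) \<partial>S \<partial>m)"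
      by (rule integral_first_step[where B = 1]) (auto simp: indicator_def)
    also have "\<dots> = (\<integral>h. \<integral>\<omega>. indicator (E n (g + h)) \<omega> \<partial>S \<partial>m)"
      by (simp add: indicator_def E_Suc)
    also have "\<dots> = (\<integral>h. measure S (E n (g + h)) \<partial>m)" by simp
    also have "\<dots> \<le> (\<integral>h. u (g + h) / c \<partial>m)"
    proof (rule integral_mono')
      show "integrable m (\<lambda>h. u (g + h) / c)"
        using u c by (intro integrable_bounded[OF prob_space_m, where B = "B / c"]) (auto simp: divide_right_mono)
      show "measure S (E n (g + h)) \<le> u (g + h) / c" for h
        unfolding E_def by (rule Suc.IH)
      show "0 \<le> u (g + h) / c" for h using u c by simp
    qed
    also have "\<dots> = u g / c" by (simp add: harm[of g])
    finally show ?thesis by (simp add: E_def)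
  qed
qed

text \<open>The finite-horizon events increase to the event without time limit, and their bound is
  uniform in the horizon.\<close>

lemma maximal_inequality:
  fixes u :: "'g \<Rightarrow> real"
  assumes [measurable]: "u \<in> borel_measurable borel"
    and u: "\<And>g. 0 \<le> u g" "\<And>g. u g \<le> B" and harm: "\<And>g. u g = (\<integral>h. u (g + h) \<partial>m)" and c: "0 < c"
  shows "measure S {\<omega>. \<exists>k. c < u (g + walk k \<omega>)} \<le> u g / c"
proof -
  define E where "E n = {\<omega>. \<exists>k\<le>n. c < u (g + walk k \<omega>)}" for n
  have E: "range E \<subseteq> sets S"
  proof -
    have "{\<omega> \<in> space S. \<exists>k\<le>n. c < u (g + walk k \<omega>)} \<in> sets S" for n by measurable
    then show ?thesis by (auto simp: E_def)
  qed
  have "incseq E" by (auto simp: incseq_def E_def intro: order_trans)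
  then have "(\<lambda>n. measure S (E n)) \<longlonglongrightarrow> measure S (\<Union>n. E n)"
    using E by (intro P.finite_Lim_measure_incseq)
  moreover have "(\<Union>n. E n) = {\<omega>. \<exists>k. c < u (g + walk k \<omega>)}" by (auto simp: E_def)
  ultimately show ?thesis
    using maximal_inequality_finite[OF assms] by (intro LIMSEQ_le_const2[of "\<lambda>n. measure S (E n)"]) (auto simp: E_def)
qed

text \<open>Replacing \<open>\<nu>\<close> by its convolution with \<open>m\<close> inserts a letter
  on the right of \<open>g\<close>, the side on which the walk grows. Hence the radius about a fixed
  \<open>z\<close> is a martingale along the walk.\<close>

lemma radius_harmonic:
  assumes \<nu>: "stationary m act \<nu>"
  shows "radius \<nu> z g = (\<integral>h. radius \<nu> z (g + h) \<partial>m)"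
proof -
  obtain D where D: "0 < D" "\<And>x y :: 'x. dist x y \<le> D" using bounded_distances by blast
  have bp: "borel_prob \<nu>" using \<nu> by (simp add: stationary_def)
  have "radius \<nu> z g = (\<integral>x. dist (act g x) z \<partial>conv act m \<nu>)"
    using \<nu> by (simp add: radius_def stationary_def)
  also have "\<dots> = (\<integral>h. \<integral>x. dist (act g (act h x)) z \<partial>\<nu> \<partial>m)"
    by (rule integral_conv[OF bp, where B = D]) (auto simp: D)
  finally show ?thesis by (simp add: radius_def act_plus)
qed

section \<open>From F-proximality to m-proximality\<close>

text \<open>At a time \<open>j\<close> of small expected spread, choose a centre \<open>z\<close>
  depending on \<open>walk j \<omega>\<close> and restart the walk there. By the maximal inequality
  the radius about \<open>z\<close> exceeds \<open>\<delta>\<close> from then on with probability at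
  most \<open>(spread + \<eta>) / \<delta>\<close>, whose expectation can be made arbitrarily
  small.\<close>

lemma eventually_small_radius:
  assumes F: "F_proximal m act" and \<nu>: "stationary m act \<nu>" and \<delta>: "0 < \<delta>"
  shows "AE \<omega> in S. \<exists>z N. \<forall>n\<ge>N. radius \<nu> z (walk n \<omega>) \<le> \<delta>"
proof -
  have bp[measurable]: "borel_prob \<nu>" using \<nu> by (simp add: stationary_def)
  obtain D where D: "0 < D" "\<And>x y :: 'x. dist x y \<le> D" using bounded_distances by blast
  obtain Q :: "'x set" where Q: "countable Q" "\<And>X. open X \<Longrightarrow> X \<noteq> {} \<Longrightarrow> \<exists>d\<in>Q. d \<in> X"
    using countable_dense_exists by blast
  \<comment> \<open>Centres are taken from the countable dense set \<open>Q\<close> to make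
    \<open>E\<close> measurable.\<close>
  define E where "E = {\<omega>. \<exists>z\<in>Q. \<exists>N. \<forall>n\<ge>N. radius \<nu> z (walk n \<omega>) \<le> \<delta>}"
  have rad[measurable]: "radius \<nu> z \<in> borel_measurable borel" for z
    using radius_measurable[OF bp, of "\<lambda>_. z" borel "\<lambda>g. g"] by simp
  have E_sets[measurable]: "E \<in> sets S"
  proof -
    have "{\<omega> \<in> space S. \<exists>z\<in>Q. \<exists>N. \<forall>n\<ge>N. radius \<nu> z (walk n \<omega>) \<le> \<delta>} \<in> sets S"
      using Q(1) by measurable
    then show ?thesis by (simp add: E_def)
  qed
  have spread_b: "\<bar>spread \<nu> \<nu> g\<bar> \<le> D" for g
    unfolding spread_def by (intro abs_integral_bounded borel_probD bp) (simp add: D)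
  have bound: "measure S (- E) \<le> ((\<integral>\<omega>. spread \<nu> \<nu> (walk j \<omega>) \<partial>S) + \<eta>) / \<delta>" if \<eta>: "0 < \<eta>" for j \<eta>
  proof -
    have inner: "(\<integral>\<omega>'. indicator (- E) (comb_seq j \<omega> \<omega>') \<partial>S) \<le> (spread \<nu> \<nu> (walk j \<omega>) + \<eta>) / \<delta>" for \<omega>
    proof -
      \<comment> \<open>One half of \<open>\<eta>\<close> pays for a centre of the form
        \<open>act (walk j \<omega>) x\<close>, the other for moving it into
        \<open>Q\<close>.\<close>
      obtain x where x: "radius \<nu> (act (walk j \<omega>) x) (walk j \<omega>) < spread \<nu> \<nu> (walk j \<omega>) + \<eta> / 2"
        using radius_near_spread[OF bp, of "\<eta> / 2"] \<eta> by auto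
      obtain z where z: "z \<in> Q" "z \<in> ball (act (walk j \<omega>) x) (\<eta> / 2)"
        using Q(2)[of "ball (act (walk j \<omega>) x) (\<eta> / 2)"] \<eta> by auto
      have "radius \<nu> z (walk j \<omega>) \<le> spread \<nu> \<nu> (walk j \<omega>) + \<eta>"
        using radius_triangle[OF bp, of z "walk j \<omega>" "act (walk j \<omega>) x"] x z by (simp add: dist_commute)
      then have r: "radius \<nu> z (walk j \<omega>) / \<delta> \<le> (spread \<nu> \<nu> (walk j \<omega>) + \<eta>) / \<delta>"
        using \<delta> by (simp add: divide_right_mono)
      define A where "A = {\<omega>'. \<exists>k. \<delta> < radius \<nu> z (walk j \<omega> + walk k \<omega>')}"
      have A: "A \<in> sets S"
      proof -
        have "{\<omega>' \<in> space S. \<exists>k. \<delta> < radius \<nu> z (walk j \<omega> + walk k \<omega>')} \<in> sets S" by measurable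
        then show ?thesis by (simp add: A_def)
      qed
      \<comment> \<open>If the radius about \<open>z\<close> stays at most \<open>\<delta>\<close>
        from time \<open>j\<close> on, then \<open>z\<close> and \<open>N = j\<close> witness
        membership in \<open>E\<close>.\<close>
      have sub: "\<omega>' \<in> A" if "comb_seq j \<omega> \<omega>' \<notin> E" for \<omega>'
      proof (rule ccontr)
        assume "\<omega>' \<notin> A"
        then have "radius \<nu> z (walk (j + k) (comb_seq j \<omega> \<omega>')) \<le> \<delta>" for k
          by (simp add: A_def walk_comb_seq not_less)
        then have "\<forall>n\<ge>j. radius \<nu> z (walk n (comb_seq j \<omega> \<omega>')) \<le> \<delta>"
          by (metis le_add_diff_inverse)
        with z(1) that show False by (auto simp: E_def)
      qed
      have "(\<integral>\<omega>'. indicator (- E) (comb_seq j \<omega> \<omega>') \<partial>S) \<le> (\<integral>\<omega>'. indicator A \<omega>' \<partial>S :: real)"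
        using A sub by (intro integral_mono') (auto simp: indicator_def intro!: integrable_S[where B = 1])
      also have "\<dots> = measure S A" using A by simp
      also have "\<dots> \<le> radius \<nu> z (walk j \<omega>) / \<delta>"
        unfolding A_def
        by (rule maximal_inequality[where B = D, OF rad radius_nonneg _ radius_harmonic[OF \<nu>] \<delta>])
           (rule abs_le_D1[OF radius_le[OF bp D(2)]])
      finally show ?thesis using r by linarith
    qed
    have int_s: "integrable S (\<lambda>\<omega>. spread \<nu> \<nu> (walk j \<omega>))"
      by (rule integrable_S[where B = D]) (auto simp: spread_b bp)
    have "measure S (- E) = (\<integral>\<omega>. indicator (- E) \<omega> \<partial>S)"
      using E_sets sets.compl_sets[OF E_sets] by (simp add: Compl_eq_Diff_UNIV)
    also have "\<dots> = (\<integral>\<omega>. \<integral>\<omega>'. indicator (- E) (comb_seq j \<omega> \<omega>') \<partial>S \<partial>S)"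
      using sets.compl_sets[OF E_sets]
      by (intro integral_split_at[where B = 1]) (auto simp: indicator_def Compl_eq_Diff_UNIV)
    also have "\<dots> \<le> (\<integral>\<omega>. (spread \<nu> \<nu> (walk j \<omega>) + \<eta>) / \<delta> \<partial>S)"
      using int_s \<eta> \<delta> by (intro integral_mono' inner) (auto intro!: divide_nonneg_nonneg add_nonneg_nonneg spread_nonneg)
    also have "\<dots> = ((\<integral>\<omega>. spread \<nu> \<nu> (walk j \<omega>) \<partial>S) + \<eta>) / \<delta>"
      using int_s P.prob_space by simp
    finally show ?thesis .
  qed
  have "measure S (- E) \<le> 0"
  proof (rule field_le_epsilon)
    fix e :: real assume e: "0 < e"
    \<comment> \<open>This amount is spent twice, on the expected spread and on
      \<open>\<eta>\<close>; division by \<open>\<delta>\<close> leaves \<open>e\<close>.\<close>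
    then have "0 < e * \<delta> / 2" using \<delta> by simp
    then obtain j where "(\<integral>\<omega>. spread \<nu> \<nu> (walk j \<omega>) \<partial>S) < e * \<delta> / 2"
      using F_proximal_small_spread[OF F bp bp] by blast
    then have "((\<integral>\<omega>. spread \<nu> \<nu> (walk j \<omega>) \<partial>S) + e * \<delta> / 2) / \<delta> \<le> e"
      using \<delta> by (simp add: field_simps)
    with bound[OF \<open>0 < e * \<delta> / 2\<close>, of j] show "measure S (- E) \<le> 0 + e" by linarith
  qed
  then have "emeasure S (- E) = 0"
    by (simp add: P.emeasure_eq_measure antisym[OF _ measure_nonneg])
  moreover have "- E \<in> sets S" using sets.compl_sets[OF E_sets] by (simp add: Compl_eq_Diff_UNIV)
  ultimately have "AE \<omega> in S. \<omega> \<notin> - E" by (intro AE_not_in) (auto simp: null_sets_def)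
  then show ?thesis by eventually_elim (auto simp: E_def)
qed

text \<open>For almost every \<open>\<omega>\<close> there are centres \<open>z k\<close> for all
  tolerances \<open>1 / Suc k\<close>. They form a Cauchy sequence, and the translates converge to
  the point mass at its limit.\<close>

lemma F_proximal_imp_m_proximal:
  assumes F: "F_proximal m act" and \<nu>: "stationary m act \<nu>"
  shows "m_proximal m act \<nu>"
proof -
  have bp: "borel_prob \<nu>" using \<nu> by (simp add: stationary_def)
  have "AE \<omega> in S. \<forall>k. \<exists>z N. \<forall>n\<ge>N. radius \<nu> z (walk n \<omega>) \<le> 1 / Suc k"
    unfolding AE_all_countable by (intro allI eventually_small_radius[OF F \<nu>]) simp
  then have "AE \<omega> in S. \<exists>z. (\<lambda>n. radius \<nu> z (walk n \<omega>)) \<longlonglongrightarrow> 0"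
  proof eventually_elim
    case (elim \<omega>)
    then obtain z N where zN: "\<And>k n. N k \<le> n \<Longrightarrow> radius \<nu> (z k) (walk n \<omega>) \<le> 1 / Suc k" by metis
    have small: "\<exists>K. \<forall>k\<ge>K. 1 / real (Suc k) < e" if "0 < e" for e :: real
    proof -
      have "eventually (\<lambda>k. inverse (real (Suc k)) < e) sequentially"
        using LIMSEQ_inverse_real_of_nat that by (rule order_tendstoD)
      then show ?thesis by (simp add: eventually_sequentially inverse_eq_divide)
    qed
    \<comment> \<open>At the later of the two times both centres are good for the same
      translate.\<close>
    have d: "dist (z k) (z l) \<le> 1 / Suc k + 1 / Suc l" for k l
      using dist_le_radius[OF bp, of "z k" "z l" "walk (max (N k) (N l)) \<omega>"]
        zN[of k "max (N k) (N l)"] zN[of l "max (N k) (N l)"] by simp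
    have "Cauchy z"
    proof (rule metric_CauchyI)
      fix e :: real assume "0 < e"
      then obtain K where K: "\<And>k. K \<le> k \<Longrightarrow> 1 / real (Suc k) < e / 2" using small[of "e / 2"] by auto
      have "dist (z k) (z l) < e" if "K \<le> k" "K \<le> l" for k l
        using d[of k l] K[OF that(1)] K[OF that(2)] by linarith
      then show "\<exists>M. \<forall>k\<ge>M. \<forall>l\<ge>M. dist (z k) (z l) < e" by blast
    qed
    then obtain w where w: "z \<longlonglongrightarrow> w" using Cauchy_convergent_iff convergent_def by blast
    have "(\<lambda>n. radius \<nu> w (walk n \<omega>)) \<longlonglongrightarrow> 0"
    proof (rule tendstoI)
      fix e :: real assume e: "0 < e"
      obtain K where K: "\<And>k. K \<le> k \<Longrightarrow> 1 / real (Suc k) < e / 2" using small[of "e / 2"] e by auto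
      have "eventually (\<lambda>k. dist (z k) w < e / 2) sequentially"
        using w e by (intro tendstoD) auto
      then obtain k where k: "K \<le> k" "dist (z k) w < e / 2"
        using eventually_ge_at_top[of K] eventually_conj eventually_happens'[OF sequentially_bot] by blast
      show "eventually (\<lambda>n. dist (radius \<nu> w (walk n \<omega>)) 0 < e) sequentially"
        using eventually_ge_at_top[of "N k"]
      proof eventually_elim
        case (elim n)
        have "radius \<nu> w (walk n \<omega>) \<le> radius \<nu> (z k) (walk n \<omega>) + dist w (z k)"
          by (rule radius_triangle[OF bp])
        also have "\<dots> < e" using zN[OF elim] K[OF k(1)] k(2) by (simp add: dist_commute)
        finally show ?case using radius_nonneg by (simp add: dist_real_def)
      qed
    qed
    then show ?case by blast
  qed
  then show ?thesis by (simp add: m_proximal_iff_radius[OF bp])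
qed

section \<open>From m-proximality and uniqueness to F-proximality\<close>

text \<open>The limit point depends on \<open>\<omega>\<close>, but the spread does not mention it
  and is at most twice the radius about it; dominated convergence applies.\<close>

lemma m_proximal_expected_spread:
  assumes \<nu>: "borel_prob \<nu>" and prox: "m_proximal m act \<nu>"
  shows "(\<lambda>n. \<integral>\<omega>. spread \<nu> \<nu> (walk n \<omega>) \<partial>S) \<longlonglongrightarrow> 0"
proof -
  obtain D where D: "0 < D" "\<And>x y :: 'x. dist x y \<le> D" using bounded_distances by blast
  have spread_b: "\<bar>spread \<nu> \<nu> g\<bar> \<le> D" for g
    unfolding spread_def by (intro abs_integral_bounded borel_probD \<nu>) (simp add: D)
  have "(\<lambda>n. \<integral>\<omega>. spread \<nu> \<nu> (walk n \<omega>) \<partial>S) \<longlonglongrightarrow> (\<integral>\<omega>. 0 \<partial>S)"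
  proof (rule integral_dominated_convergence[where w = "\<lambda>_. D"])
    have "AE \<omega> in S. \<exists>z. (\<lambda>n. radius \<nu> z (walk n \<omega>)) \<longlonglongrightarrow> 0"
      using prox by (simp add: m_proximal_iff_radius[OF \<nu>])
    then show "AE \<omega> in S. (\<lambda>n. spread \<nu> \<nu> (walk n \<omega>)) \<longlonglongrightarrow> 0"
    proof eventually_elim
      case (elim \<omega>)
      then obtain z where "(\<lambda>n. radius \<nu> z (walk n \<omega>)) \<longlonglongrightarrow> 0" by blast
      then have "(\<lambda>n. 2 * radius \<nu> z (walk n \<omega>)) \<longlonglongrightarrow> 0" by (rule tendsto_mult_right_zero)
      then show ?case
        by (rule Lim_null_comparison[rotated])
           (simp add: spread_nonneg spread_le_radius[OF \<nu>])
    qed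
    show "(\<lambda>\<omega>. spread \<nu> \<nu> (walk n \<omega>)) \<in> borel_measurable S" for n
      by (intro spread_measurable \<nu> walk_measurable)
    show "AE \<omega> in S. norm (spread \<nu> \<nu> (walk n \<omega>)) \<le> D" for n
      by (simp add: spread_b)
  qed simp_all
  then show ?thesis by simp
qed

lemma m_proximal_imp_F_proximal:
  assumes \<nu>: "stationary m act \<nu>" and uniq: "\<And>\<nu>'. stationary m act \<nu>' \<Longrightarrow> \<nu>' = \<nu>"
    and prox: "m_proximal m act \<nu>"
  shows "F_proximal m act"
  unfolding F_proximal_iff
proof (intro allI, rule tendstoI)
  fix x y :: 'x and e :: real assume e: "0 < e"
  have bp: "borel_prob \<nu>" using \<nu> by (simp add: stationary_def)
  note prob = borel_probD(1)[OF bp]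
  note [measurable_cong] = borel_probD(2)[OF bp]
  obtain D where D: "0 < D" "\<And>x y :: 'x. dist x y \<le> D" using bounded_distances by blast
  have rad: "\<bar>radius \<nu> z g\<bar> \<le> D" for z g by (rule radius_le[OF bp D(2)])
  have "eventually (\<lambda>n. (\<integral>\<omega>. spread \<nu> \<nu> (walk n \<omega>) \<partial>S) < e / 4) sequentially"
    using m_proximal_expected_spread[OF bp prox] e by (intro order_tendstoD) auto
  \<comment> \<open>\<open>h\<close> enters twice below, so \<open>e / 4\<close> brings the limit of
    the upper bound under \<open>e / 2\<close>.\<close>
  then obtain k where k: "(\<integral>\<omega>. spread \<nu> \<nu> (walk k \<omega>) \<partial>S) < e / 4"
    using eventually_happens'[OF sequentially_bot] by blast
  define h where "h u = (\<integral>\<omega>. radius \<nu> (act (walk k \<omega>) u) (walk k \<omega>) \<partial>S)" for u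
  \<comment> \<open>Dominated convergence over the walk and, inside it, over \<open>\<nu>\<close>.
    Continuity admits \<open>h\<close> to \<open>unique_stationary_averages\<close>.\<close>
  have h_cont: "continuous_on UNIV h"
    unfolding h_def
  proof (rule continuous_on_integral_bounded[where B = D])
    show "continuous_on UNIV (\<lambda>u. radius \<nu> (act (walk k \<omega>) u) (walk k \<omega>))" for \<omega>
      unfolding radius_def
    proof (rule continuous_on_integral_bounded[where B = D])
      show "continuous_on UNIV (\<lambda>u. dist (act (walk k \<omega>) x) (act (walk k \<omega>) u))" for x
        by (intro continuous_intros continuous_on_act)
    qed (use prob in \<open>auto simp: D prob_space_def\<close>)
  qed (auto simp: rad bp P.finite_measure_axioms)
  have h_nonneg: "0 \<le> h u" for u unfolding h_def by (simp add: radius_nonneg)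
  have h_le: "\<bar>h u\<bar> \<le> D" for u unfolding h_def by (intro abs_integral_bounded prob_space_S rad)
  have [measurable]: "h \<in> borel_measurable borel" by (rule borel_measurable_continuous_onI[OF h_cont])
  have h_int: "(\<integral>u. h u \<partial>\<nu>) < e / 4"
  proof -
    have "(\<integral>u. h u \<partial>\<nu>) = (\<integral>\<omega>. \<integral>u. radius \<nu> (act (walk k \<omega>) u) (walk k \<omega>) \<partial>\<nu> \<partial>S)"
      unfolding h_def by (rule Fubini_bounded(2)[where B = D]) (auto simp: rad bp prob prob_space_S)
    also have "\<dots> = (\<integral>\<omega>. spread \<nu> \<nu> (walk k \<omega>) \<partial>S)" by (simp only: spread_eq_integral_radius)
    finally show ?thesis using k by simp
  qed
  define H where "H i x = (\<integral>\<omega>. h (act (walk i \<omega>) x) \<partial>S)" for i x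
  have H_nonneg: "0 \<le> H i x" for i x unfolding H_def by (simp add: h_nonneg)
  have key: "mean_dist (k + i) x y \<le> H i x + H i y" for i
  proof -
    have int_h: "integrable S (\<lambda>\<omega>. h (act (walk i \<omega>) v))" for v
      by (rule integrable_S[where B = D]) (auto simp: h_le)
    have int_r: "integrable S (\<lambda>\<omega>. radius \<nu> (act (walk k \<omega>) u) (walk k \<omega>))" for u
      by (rule integrable_S[where B = D]) (auto simp: rad bp)
    \<comment> \<open>The walk splits into \<open>k\<close> letters and an independent block of
      \<open>i\<close> letters, and the latter acts first. The points \<open>u\<close> and
      \<open>v\<close> it reaches are then compared through a \<open>\<nu>\<close>-random third
      point.\<close>
    have "mean_dist (k + i) x y = (\<integral>\<omega>. \<integral>\<omega>'. dist (act (walk k \<omega>) (act (walk i \<omega>') x)) (act (walk k \<omega>) (act (walk i \<omega>') y)) \<partial>S \<partial>S)"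
      unfolding mean_dist_def
      by (subst expectation_walk_add[where B = D]) (auto simp: D act_plus)
    also have "\<dots> = (\<integral>\<omega>'. \<integral>\<omega>. dist (act (walk k \<omega>) (act (walk i \<omega>') x)) (act (walk k \<omega>) (act (walk i \<omega>') y)) \<partial>S \<partial>S)"
      by (rule Fubini_bounded(2)[symmetric, where B = D]) (auto simp: D prob_space_S)
    also have "\<dots> \<le> (\<integral>\<omega>'. h (act (walk i \<omega>') x) + h (act (walk i \<omega>') y) \<partial>S)"
    proof (rule integral_mono')
      fix \<omega>'
      define u v where "u = act (walk i \<omega>') x" and "v = act (walk i \<omega>') y"
      have "(\<integral>\<omega>. dist (act (walk k \<omega>) u) (act (walk k \<omega>) v) \<partial>S)
          \<le> (\<integral>\<omega>. radius \<nu> (act (walk k \<omega>) u) (walk k \<omega>) + radius \<nu> (act (walk k \<omega>) v) (walk k \<omega>) \<partial>S)"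
        using int_r by (intro integral_mono' dist_le_radius[OF bp]) (auto intro!: add_nonneg_nonneg radius_nonneg)
      also have "\<dots> = h u + h v" using int_r by (simp add: h_def)
      finally show "(\<integral>\<omega>. dist (act (walk k \<omega>) (act (walk i \<omega>') x)) (act (walk k \<omega>) (act (walk i \<omega>') y)) \<partial>S)
          \<le> h (act (walk i \<omega>') x) + h (act (walk i \<omega>') y)" by (simp add: u_def v_def)
    qed (use int_h h_nonneg in auto)
    also have "\<dots> = H i x + H i y" using int_h by (simp add: H_def)
    finally show ?thesis .
  qed
  have md: "mean_dist j x y \<le> D" for j
    using abs_integral_bounded[OF prob_space_S, of "\<lambda>\<omega>. dist (act (walk j \<omega>) x) (act (walk j \<omega>) y)" D] D
    by (simp add: mean_dist_def abs_le_iff)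
  have avg: "(1 / real n) * (\<Sum>j = 1..n. mean_dist j x y)
      \<le> real k * D * inverse (real n) + ((1 / real n) * (\<Sum>j = 1..n. H j x) + (1 / real n) * (\<Sum>j = 1..n. H j y))" for n
  proof -
    \<comment> \<open>Lengthening the sum to \<open>k + n\<close> adds only nonnegative terms. The
      first \<open>k\<close> terms cost at most \<open>D\<close> each, negligible after division by
      \<open>n\<close>, and \<open>key\<close> covers the rest.\<close>
    have "(\<Sum>j = 1..n. mean_dist j x y) \<le> (\<Sum>j = 1..k + n. mean_dist j x y)"
      by (intro sum_mono2) (auto simp: mean_dist_nonneg)
    also have "\<dots> = (\<Sum>j = 1..k. mean_dist j x y) + (\<Sum>j = k + 1..k + n. mean_dist j x y)"
      by (intro sum.ub_add_nat) simp
    also have "(\<Sum>j = k + 1..k + n. mean_dist j x y) = (\<Sum>i = 1..n. mean_dist (k + i) x y)"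
      using sum.shift_bounds_cl_nat_ivl[of "\<lambda>j. mean_dist j x y" 1 k n] by (simp add: add.commute)
    also have "(\<Sum>j = 1..k. mean_dist j x y) \<le> (\<Sum>j = 1..k. D)" by (intro sum_mono md)
    also have "(\<Sum>i = 1..n. mean_dist (k + i) x y) \<le> (\<Sum>i = 1..n. H i x + H i y)" by (intro sum_mono key)
    finally have "(\<Sum>j = 1..n. mean_dist j x y) \<le> k * D + ((\<Sum>i = 1..n. H i x) + (\<Sum>i = 1..n. H i y))"
      by (simp add: sum.distrib)
    from mult_left_mono[OF this, of "1 / real n"] show ?thesis
      by (simp add: distrib_left divide_inverse mult_ac)
  qed
  have "(\<lambda>n. real k * D * inverse (real n) + ((1 / real n) * (\<Sum>j = 1..n. H j x) + (1 / real n) * (\<Sum>j = 1..n. H j y)))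
      \<longlonglongrightarrow> real k * D * 0 + ((\<integral>u. h u \<partial>\<nu>) + (\<integral>u. h u \<partial>\<nu>))"
    unfolding H_def
    by (intro tendsto_add tendsto_mult tendsto_const lim_inverse_n unique_stationary_averages[OF uniq h_cont])
  moreover have "real k * D * 0 + ((\<integral>u. h u \<partial>\<nu>) + (\<integral>u. h u \<partial>\<nu>)) < e"
    using h_int e by linarith
  ultimately have "eventually (\<lambda>n. real k * D * inverse (real n) + ((1 / real n) * (\<Sum>j = 1..n. H j x) + (1 / real n) * (\<Sum>j = 1..n. H j y)) < e) sequentially"
    by (rule order_tendstoD)
  then show "eventually (\<lambda>n. dist ((1 / real n) * (\<Sum>j = 1..n. mean_dist j x y)) 0 < e) sequentially"
  proof eventually_elim
    case (elim n)
    have "0 \<le> (1 / real n) * (\<Sum>j = 1..n. mean_dist j x y)"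
      by (intro mult_nonneg_nonneg sum_nonneg mean_dist_nonneg) simp
    then show ?case using avg[of n] elim unfolding dist_real_def diff_zero by linarith
  qed
qed

end

theorem theorem7p5:
  fixes m :: "'g::{topological_group_add, second_countable_topology} measure"
    and act :: "'g \<Rightarrow> 'x::compact_metric_space \<Rightarrow> 'x"
  assumes "locally_compact_space (euclidean :: 'g topology)"
    and "borel_prob m"
    and "continuous_action act"
  shows "F_proximal m act \<longleftrightarrow>
    (\<exists>\<nu>. stationary m act \<nu> \<and> (\<forall>\<nu>'. stationary m act \<nu>' \<longrightarrow> \<nu>' = \<nu>) \<and> m_proximal m act \<nu>)"
proof -
  interpret random_action m act using assms by unfold_locales
  show ?thesis
  proof
    assume F: "F_proximal m act"
    \<comment> \<open>Existence comes from compactness: the occupation measures of any point have a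
      stationary limit point.\<close>
    obtain \<nu> where "stationary m act \<nu>"
      using stationary_subsequence[of id] by (auto simp: strict_mono_id)
    with F show "\<exists>\<nu>. stationary m act \<nu> \<and> (\<forall>\<nu>'. stationary m act \<nu>' \<longrightarrow> \<nu>' = \<nu>) \<and> m_proximal m act \<nu>"
      using F_proximal_stationary_unique F_proximal_imp_m_proximal by blast
  qed (use m_proximal_imp_F_proximal in blast)
qed

end
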